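(* For each $I$ with $\{n\}\subseteq I\subseteq [n]$ let $e_I'=\mathrm{lm}_{\mathrm{lex}}(\tilde d_I)/d_n$ and let $V_I'=kG\,e_I'\subseteq S$ be the $kG$-submodule of $S$ generated by $e_I'$. Then the map $$\bigoplus_{\{n\}\subseteq I\subseteq [n]} k[d_I]\otimes_k V_I'\longrightarrow S,\qquad d\otimes_k v\longmapsto dv,$$ is an isomorphism of $kG$-modules; that is, the modules $V_I'$ give a structure theorem for $S$.
   Context: Let $k$ be a unital ring, not necessarily commutative, such that $ab=0$ implies $a=0$ or $b=0$ for $a,b\in k$. Fix an integer $n\ge 1$, let $[n]=\{1,\dots,n\}$, and let $S=k[x_1,\dots,x_n]$ be the polynomial ring in commuting variables with $ax_i=x_ia$ for all $a\in k$ and all $i$. Let $G=\mathrm{Sym}(x_1,\dots,x_n)$ be the symmetric group on the variables, acting on $S$ by permuting the variables (as ring automorphisms fixing $k$ pointwise). Let $d_i$ be the $i$-th elementary symmetric polynomial in $x_1,\dots,x_n$ (so $d_n=x_1\cdots x_n$). For $I\subseteq [n]$ let $k[d_I]=k[d_i\mid i\in I]\subseteq S$, which is a polynomial ring in the $d_i$, $i\in I$, and let $\tilde d_I=\prod_{i\in I}d_i$. Let $\mathrm{lm}_{\mathrm{lex}}$ denote the leading monomial for the usual lexicographic order on monomials in $x_1,\dots,x_n$ (with $x_1>x_2>\dots>x_n$); so for $n\in I$, $\mathrm{lm}_{\mathrm{lex}}(\tilde d_I)/d_n=\prod_{i\in I\setminus\{n\}}x_1x_2\cdots x_i$. $G$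 acts on $k[d_I]\otimes_k V_I'$ by $g(d\otimes v)=d\otimes gv$, and $k$ acts by left multiplication. A structure theorem for $S$ over $k[d_1,\dots,d_n]G$ is a choice of finitely generated $kG$-submodules $X_I\subseteq S$, one for each $I\subseteq[n]$, such that $\bigoplus_{I\subseteq[n]}k[d_I]\otimes_kX_I\to S$, $d\otimes x\mapsto dx$, is an isomorphism of $kG$-modules; here $X_I=V_I'$ if $n\in I$ and $X_I=0$ if $n\notin I$. *)

theory Defs
  imports "HOL-Algebra.Free_Abelian_Groups" "HOL-Algebra.Generated_Groups" "HOL-Combinatorics.Permutations"
begin

section \<open>The polynomial ring and the action of the symmetric group\<close>

text \<open>
  Polynomials in commuting variables \<open>x\<^sub>0, x\<^sub>1, x\<^sub>2, \<dots>\<close> over a possibly noncommutative ring of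
  coefficients, as finitely supported functions on exponent vectors. The convolution product
  multiplies coefficients in the given order, so that the variables are central.
\<close>

type_synonym 'k mpol = "(nat \<Rightarrow>\<^sub>0 nat) \<Rightarrow>\<^sub>0 'k"

definition cst :: "'k::ring_1 \<Rightarrow> 'k mpol"
  where "cst c = Poly_Mapping.single 0 c"

definition xmonom :: "(nat \<Rightarrow>\<^sub>0 nat) \<Rightarrow> 'k::ring_1 mpol"
  where "xmonom m = Poly_Mapping.single m 1"

definition poly_ring :: "nat \<Rightarrow> 'k::ring_1 mpol set"
  where "poly_ring n = {p. \<forall>m\<in>Poly_Mapping.keys p. Poly_Mapping.keys m \<subseteq> {1..n}}"

definition perm_exp :: "(nat \<Rightarrow> nat) \<Rightarrow> (nat \<Rightarrow>\<^sub>0 nat) \<Rightarrow> (nat \<Rightarrow>\<^sub>0 nat)"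
  where "perm_exp \<sigma> m =
    (\<Sum>i\<in>Poly_Mapping.keys m. Poly_Mapping.single (\<sigma> i) (Poly_Mapping.lookup m i))"

text \<open>The substitution \<open>x\<^sub>i \<mapsto> x\<^bsub>\<sigma> i\<^esub>\<close>, which fixes all coefficients.\<close>

definition perm_act :: "(nat \<Rightarrow> nat) \<Rightarrow> 'k::ring_1 mpol \<Rightarrow> 'k mpol"
  where "perm_act \<sigma> p =
    (\<Sum>m\<in>Poly_Mapping.keys p. Poly_Mapping.single (perm_exp \<sigma> m) (Poly_Mapping.lookup p m))"

section \<open>Elementary symmetric polynomials and leading monomials\<close>

definition esym :: "nat \<Rightarrow> nat \<Rightarrow> 'k::ring_1 mpol"
  where "esym n i =
    (\<Sum>A\<in>{A. A \<subseteq> {1..n} \<and> card A = i}. xmonom (\<Sum>j\<in>A. Poly_Mapping.single j 1))"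

text \<open>The subring generated by the constants and the \<open>d\<^sub>i\<close> with \<open>i \<in> I\<close>.\<close>

inductive_set esym_subring :: "nat \<Rightarrow> nat set \<Rightarrow> 'k::ring_1 mpol set"
  for n :: nat and I :: "nat set"
  where
    cst: "cst c \<in> esym_subring n I"
  | gen: "i \<in> I \<Longrightarrow> esym n i \<in> esym_subring n I"
  | add: "\<lbrakk>p \<in> esym_subring n I; q \<in> esym_subring n I\<rbrakk> \<Longrightarrow> p + q \<in> esym_subring n I"
  | mult: "\<lbrakk>p \<in> esym_subring n I; q \<in> esym_subring n I\<rbrakk> \<Longrightarrow> p * q \<in> esym_subring n I"

text \<open>
  The type of polynomials is not commutative, hence the list product; the factors \<open>d\<^sub>i\<close>
  commute with each other, so that their order does not matter.
\<close>

definition esym_prod :: "nat \<Rightarrow> nat set \<Rightarrow> 'k::ring_1 mpol"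
  where "esym_prod n I = prod_list (map (esym n) (sorted_list_of_set I))"

text \<open>
  The library order on exponent vectors compares them at the smallest index where they differ;
  this is the lexicographic order with \<open>x\<^sub>1 > x\<^sub>2 > \<dots>\<close>. Only meaningful for \<open>p \<noteq> 0\<close>.
\<close>

definition lex_lead_exp :: "'k::ring_1 mpol \<Rightarrow> (nat \<Rightarrow>\<^sub>0 nat)"
  where "lex_lead_exp p = Max (Poly_Mapping.keys p)"

text \<open>
  The quotient of the leading monomial of \<open>\<Prod>\<^bsub>i\<in>I\<^esub> d\<^sub>i\<close> by \<open>d\<^sub>n = x\<^sub>1 \<cdots> x\<^sub>n\<close>, written through the
  difference of exponents. For \<open>n \<in> I\<close> the division is exact, so the subtraction of natural
  numbers does not truncate. The type of coefficients has to be supplied since the exponents are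
  those of polynomials over that type.
\<close>

definition e_gen :: "nat \<Rightarrow> nat set \<Rightarrow> 'k::ring_1 mpol"
  where "e_gen n I = xmonom (lex_lead_exp (esym_prod n I :: 'k mpol) - lex_lead_exp (esym n n :: 'k mpol))"

section \<open>Modules over the group ring\<close>

text \<open>
  A left module over the group ring \<open>kG\<close>, where \<open>G\<close> consists of the permutations of \<open>{1..n}\<close>:
  a left \<open>k\<close>-module with an action of \<open>G\<close> by \<open>k\<close>-linear maps. The underlying abelian group is
  written multiplicatively, as in the library constructions for groups used below.
\<close>

record ('a, 'k) kG_mod = "'a monoid" +
  smul :: "'k \<Rightarrow> 'a \<Rightarrow> 'a"
  gact :: "(nat \<Rightarrow> nat) \<Rightarrow> 'a \<Rightarrow> 'a"

definition kG_module :: "nat \<Rightarrow> ('a, 'k::ring_1) kG_mod \<Rightarrow> bool"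
  where "kG_module n M \<longleftrightarrow>
    comm_group M \<and>
    (\<forall>c. \<forall>x\<in>carrier M. smul M c x \<in> carrier M) \<and>
    (\<forall>c. \<forall>x\<in>carrier M. \<forall>y\<in>carrier M. smul M c (x \<otimes>\<^bsub>M\<^esub> y) = smul M c x \<otimes>\<^bsub>M\<^esub> smul M c y) \<and>
    (\<forall>b c. \<forall>x\<in>carrier M. smul M (b + c) x = smul M b x \<otimes>\<^bsub>M\<^esub> smul M c x) \<and>
    (\<forall>b c. \<forall>x\<in>carrier M. smul M (b * c) x = smul M b (smul M c x)) \<and>
    (\<forall>x\<in>carrier M. smul M 1 x = x) \<and>
    (\<forall>g. g permutes {1..n} \<longrightarrow> (\<forall>x\<in>carrier M. gact M g x \<in> carrier M)) \<and>
    (\<forall>g. g permutes {1..n} \<longrightarrow>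
      (\<forall>x\<in>carrier M. \<forall>y\<in>carrier M. gact M g (x \<otimes>\<^bsub>M\<^esub> y) = gact M g x \<otimes>\<^bsub>M\<^esub> gact M g y)) \<and>
    (\<forall>g h. g permutes {1..n} \<longrightarrow> h permutes {1..n} \<longrightarrow>
      (\<forall>x\<in>carrier M. gact M (g \<circ> h) x = gact M g (gact M h x))) \<and>
    (\<forall>x\<in>carrier M. gact M id x = x) \<and>
    (\<forall>g c. g permutes {1..n} \<longrightarrow>
      (\<forall>x\<in>carrier M. gact M g (smul M c x) = smul M c (gact M g x)))"

definition kG_iso ::
    "nat \<Rightarrow> ('a, 'k::ring_1) kG_mod \<Rightarrow> ('b, 'k) kG_mod \<Rightarrow> ('a \<Rightarrow> 'b) \<Rightarrow> bool"
  where "kG_iso n M N f \<longleftrightarrow>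
    kG_module n M \<and> kG_module n N \<and> f \<in> iso M N \<and>
    (\<forall>c. \<forall>x\<in>carrier M. f (smul M c x) = smul N c (f x)) \<and>
    (\<forall>g. g permutes {1..n} \<longrightarrow> (\<forall>x\<in>carrier M. f (gact M g x) = gact N g (f x)))"

definition poly_module :: "nat \<Rightarrow> ('k::ring_1 mpol, 'k) kG_mod"
  where "poly_module n =
    \<lparr>carrier = poly_ring n, monoid.mult = (+), one = 0,
     smul = (\<lambda>c p. cst c * p), gact = perm_act\<rparr>"

definition kG_submodule :: "nat \<Rightarrow> 'k::ring_1 mpol set \<Rightarrow> bool"
  where "kG_submodule n V \<longleftrightarrow>
    V \<subseteq> poly_ring n \<and> 0 \<in> V \<and>
    (\<forall>p\<in>V. \<forall>q\<in>V. p + q \<in> V) \<and>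
    (\<forall>c. \<forall>p\<in>V. cst c * p \<in> V) \<and>
    (\<forall>g. g permutes {1..n} \<longrightarrow> (\<forall>p\<in>V. perm_act g p \<in> V))"

definition kG_span :: "nat \<Rightarrow> 'k::ring_1 mpol set \<Rightarrow> 'k mpol set"
  where "kG_span n E = \<Inter>{V. kG_submodule n V \<and> E \<subseteq> V}"

definition V_gen :: "nat \<Rightarrow> nat set \<Rightarrow> 'k::ring_1 mpol set"
  where "V_gen n I = kG_span n {e_gen n I}"

section \<open>The tensor product over a noncommutative ring\<close>

text \<open>
  The tensor product \<open>A \<otimes>\<^sub>k B\<close> of a right \<open>k\<close>-module \<open>A\<close> and a left \<open>k\<close>-module \<open>B\<close> of polynomials,
  as the free abelian group on \<open>A \<times> B\<close> modulo the relations of biadditivity and balancedness.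
\<close>

definition tensor_relators ::
    "'k::ring_1 mpol set \<Rightarrow> 'k mpol set \<Rightarrow> ('k mpol \<times> 'k mpol \<Rightarrow>\<^sub>0 int) set"
  where "tensor_relators A B =
    {frag_of (a + a', b) - frag_of (a, b) - frag_of (a', b) |a a' b. a \<in> A \<and> a' \<in> A \<and> b \<in> B} \<union>
    {frag_of (a, b + b') - frag_of (a, b) - frag_of (a, b') |a b b'. a \<in> A \<and> b \<in> B \<and> b' \<in> B} \<union>
    {frag_of (a * cst c, b) - frag_of (a, cst c * b) |a b c. a \<in> A \<and> b \<in> B}"

definition tensor_kernel ::
    "'k::ring_1 mpol set \<Rightarrow> 'k mpol set \<Rightarrow> ('k mpol \<times> 'k mpol \<Rightarrow>\<^sub>0 int) set"
  where "tensor_kernel A B = generate (free_Abelian_group (A \<times> B)) (tensor_relators A B)"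

text \<open>The coset of \<open>f t\<close> for any representative \<open>t\<close> of the coset \<open>X\<close>; for \<open>f\<close> preserving the kernel.\<close>

definition tensor_map ::
    "'k::ring_1 mpol set \<Rightarrow> 'k mpol set \<Rightarrow> ('k mpol \<times> 'k mpol \<Rightarrow> 'k mpol \<times> 'k mpol) \<Rightarrow>
     ('k mpol \<times> 'k mpol \<Rightarrow>\<^sub>0 int) set \<Rightarrow> ('k mpol \<times> 'k mpol \<Rightarrow>\<^sub>0 int) set"
  where "tensor_map A B f X =
    tensor_kernel A B <#>\<^bsub>free_Abelian_group (A \<times> B)\<^esub> (frag_extend (\<lambda>z. frag_of (f z)) ` X)"

text \<open>The scalars act by \<open>c (a \<otimes> b) = (c a) \<otimes> b\<close> and the group by \<open>g (a \<otimes> b) = a \<otimes> g b\<close>.\<close>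

definition tensor_module ::
    "'k::ring_1 mpol set \<Rightarrow> 'k mpol set \<Rightarrow> (('k mpol \<times> 'k mpol \<Rightarrow>\<^sub>0 int) set, 'k) kG_mod"
  where "tensor_module A B =
    monoid.extend (free_Abelian_group (A \<times> B) Mod tensor_kernel A B)
      (kG_mod.fields
        (\<lambda>c. tensor_map A B (\<lambda>(a, b). (cst c * a, b)))
        (\<lambda>g. tensor_map A B (\<lambda>(a, b). (a, perm_act g b))))"

text \<open>
  The additive map with \<open>a \<otimes> b \<mapsto> a b\<close>: the common value, over all representatives in the coset
  \<open>X\<close>, of the additive extension of \<open>(a, b) \<mapsto> a b\<close> to the free abelian group.
\<close>

definition tensor_mult :: "('k::ring_1 mpol \<times> 'k mpol \<Rightarrow>\<^sub>0 int) set \<Rightarrow> 'k mpol"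
  where "tensor_mult X =
    the_elem ((\<lambda>t. \<Sum>z\<in>Poly_Mapping.keys t.
                      of_int (Poly_Mapping.lookup t z) * (fst z * snd z)) ` X)"

section \<open>Structure theorems\<close>

definition direct_sum_module ::
    "'i set \<Rightarrow> ('i \<Rightarrow> ('a, 'k::ring_1) kG_mod) \<Rightarrow> ('i \<Rightarrow> 'a, 'k) kG_mod"
  where "direct_sum_module J M =
    monoid.extend (sum_group J M)
      (kG_mod.fields
        (\<lambda>c x. \<lambda>i\<in>J. smul (M i) c (x i))
        (\<lambda>g x. \<lambda>i\<in>J. gact (M i) g (x i)))"

definition structure_source ::
    "nat \<Rightarrow> nat set set \<Rightarrow> (nat set \<Rightarrow> 'k::ring_1 mpol set) \<Rightarrow>
     (nat set \<Rightarrow> ('k mpol \<times> 'k mpol \<Rightarrow>\<^sub>0 int) set, 'k) kG_mod"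
  where "structure_source n J X = direct_sum_module J (\<lambda>I. tensor_module (esym_subring n I) (X I))"

definition structure_map ::
    "nat set set \<Rightarrow> (nat set \<Rightarrow> ('k::ring_1 mpol \<times> 'k mpol \<Rightarrow>\<^sub>0 int) set) \<Rightarrow> 'k mpol"
  where "structure_map J x = (\<Sum>I\<in>J. tensor_mult (x I))"

definition structure_theorem :: "nat \<Rightarrow> (nat set \<Rightarrow> 'k::ring_1 mpol set) \<Rightarrow> bool"
  where "structure_theorem n X \<longleftrightarrow>
    (\<forall>I\<in>Pow {1..n}. \<exists>E. finite E \<and> E \<subseteq> poly_ring n \<and> X I = kG_span n E) \<and>
    kG_iso n (structure_source n (Pow {1..n}) X) (poly_module n) (structure_map (Pow {1..n}))"

end

(*
  The packed exponent vectors, those whose set of values is {0, ..., r} for some r, are the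
  exponents of the monomials in the orbits of the e_I'. Splitting the
  exponent vector u of an arbitrary monomial into a packed vector with the same pattern of
  equalities and inequalities, and a remainder, attaches to u a set I, a multiset M on I and a
  monomial m in the orbit of e_I'; this is a bijection. Among the monomials of d_M m, the product
  of m and the d_i for i in M, the exponent u occurs with coefficient 1 and has the strictly
  largest sum of squares: a term of d_M m arises by adding indicator vectors of sets A of size i,
  and the sum of squares is maximal exactly if every A consists of the positions of the i largest
  entries of m, which are unique as i is in I. The sum of squares is invariant under permutations,
  so that unitriangularity holds for all orbits at once, and the products d_M m form a basis of S
  over k. Every tensor in k[d_I] (x) V_I' is a left linear combination of the
  elements d_M (x) m, which the multiplication map sends to this basis.
*)
theory Submission
  imports Defs
begin

text \<open>The lexicographic order defines the e_I' but cannot separate the proposed basis. For n =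
  2, both d_1 x_2 (from I = {1,2}) and d_2 (from I = {2}, where e_I' = 1) have the lexicographic
  leading monomial x_1 x_2; by sums of squares d_1 x_2 is led by x_2^2 instead. The price is that
  comparing sums of squares is neither a total order nor compatible with multiplication. Hence the
  induction on M has to carry a bound on partial sums of exponents, and ties between different basis
  elements are excluded by recovering the whole triple (I, M, m) from its leading exponent. Sorted
  decreasingly, that exponent is the conjugate partition of the single multiset S = (I - {n}) + M.
  As M lives on I, the support of S together with n is I, and then M is the remainder. On the tensor
  side only the existence of an expansion in the elements d_M (x) m is proved; uniqueness of its
  coefficients is imported from linear independence in S.\<close>

declare One_nat_def [simp del]

text \<open>Closure under sums only: the scalars sit in the generators \<open>cst c * x\<close>, so
  inductions never have to distinguish left from right multiplication.\<close>

inductive_set add_span :: "'a::comm_monoid_add set \<Rightarrow> 'a set"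
  for X :: "'a set"
  where
    zero: "0 \<in> add_span X"
  | base: "x \<in> X \<Longrightarrow> x \<in> add_span X"
  | add: "\<lbrakk>x \<in> add_span X; y \<in> add_span X\<rbrakk> \<Longrightarrow> x + y \<in> add_span X"

lemma add_span_sum: "(\<And>i. i \<in> A \<Longrightarrow> f i \<in> add_span X) \<Longrightarrow> sum f A \<in> add_span X"
  by (induction A rule: infinite_finite_induct) (auto intro: add_span.intros)

lemma sum_keys_superset:
  assumes "finite Z" "Poly_Mapping.keys p \<subseteq> Z" "\<And>m. f m 0 = 0"
  shows "(\<Sum>m\<in>Poly_Mapping.keys p. f m (Poly_Mapping.lookup p m)) = (\<Sum>m\<in>Z. f m (Poly_Mapping.lookup p m))"
  using assms by (intro sum.mono_neutral_left) (auto simp: in_keys_iff)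

lemma poly_mapping_sum_single:
  "(\<Sum>m\<in>Poly_Mapping.keys p. Poly_Mapping.single m (Poly_Mapping.lookup p m)) = p"
proof (rule poly_mapping_eqI)
  fix k
  show "Poly_Mapping.lookup (\<Sum>m\<in>Poly_Mapping.keys p. Poly_Mapping.single m (Poly_Mapping.lookup p m)) k
    = Poly_Mapping.lookup p k"
    by (cases "k \<in> Poly_Mapping.keys p")
      (auto simp: lookup_sum lookup_single when_def in_keys_iff sum.delta' if_distrib cong: if_cong)
qed

lemma poly_mapping_single_induct [case_names zero single add]:
  fixes p :: "'a \<Rightarrow>\<^sub>0 'b::comm_monoid_add"
  assumes "P 0" "\<And>m c. P (Poly_Mapping.single m c)" "\<And>p q. P p \<Longrightarrow> P q \<Longrightarrow> P (p + q)"
  shows "P p"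
proof -
  have "P (\<Sum>m\<in>A. Poly_Mapping.single m (Poly_Mapping.lookup p m))" for A
    by (induction A rule: infinite_finite_induct) (auto intro: assms)
  then show ?thesis
    using poly_mapping_sum_single[of p] by metis
qed

section \<open>Permutation of variables\<close>

text \<open>Evaluating at \<open>\<sigma> j\<close> avoids the inverse permutation. Together with
  \<open>perm_exp_eqI\<close> this characterizes \<open>perm_exp\<close> without its defining
  sum.\<close>

lemma lookup_perm_exp:
  assumes "bij \<sigma>"
  shows "Poly_Mapping.lookup (perm_exp \<sigma> m) (\<sigma> j) = Poly_Mapping.lookup m j"
proof -
  have "\<sigma> i = \<sigma> j \<longleftrightarrow> i = j" for i
    using assms by (auto dest: bij_is_inj injD)
  then show ?thesis
    by (auto simp: perm_exp_def lookup_sum lookup_single when_def in_keys_iff)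
qed

lemma perm_exp_eqI:
  assumes "bij \<sigma>" "\<And>j. Poly_Mapping.lookup m' (\<sigma> j) = Poly_Mapping.lookup m j"
  shows "perm_exp \<sigma> m = m'"
proof (rule poly_mapping_eqI)
  fix k
  obtain j where "k = \<sigma> j"
    using assms(1) by (metis bij_pointE)
  then show "Poly_Mapping.lookup (perm_exp \<sigma> m) k = Poly_Mapping.lookup m' k"
    using assms by (simp add: lookup_perm_exp)
qed

lemma perm_exp_add: "bij \<sigma> \<Longrightarrow> perm_exp \<sigma> (m + m') = perm_exp \<sigma> m + perm_exp \<sigma> m'"
  by (rule perm_exp_eqI) (auto simp: lookup_add lookup_perm_exp)

lemma perm_exp_zero [simp]: "perm_exp \<sigma> 0 = 0"
  by (simp add: perm_exp_def)

lemma perm_exp_id [simp]: "perm_exp id m = m"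
  by (rule perm_exp_eqI) auto

lemma perm_exp_comp: "bij \<sigma> \<Longrightarrow> bij \<tau> \<Longrightarrow> perm_exp (\<sigma> \<circ> \<tau>) m = perm_exp \<sigma> (perm_exp \<tau> m)"
  by (rule perm_exp_eqI) (auto simp: lookup_perm_exp bij_comp)

lemma bij_perm_exp:
  assumes "bij \<sigma>"
  shows "bij (perm_exp \<sigma>)"
proof (rule o_bij)
  let ?\<tau> = "inv_into UNIV \<sigma>"
  have "bij ?\<tau>" "\<sigma> \<circ> ?\<tau> = id" "?\<tau> \<circ> \<sigma> = id"
    using assms by (auto simp: bij_imp_bij_inv bij_is_surj bij_is_inj surj_iff[symmetric] inj_iff[symmetric])
  then have "perm_exp ?\<tau> (perm_exp \<sigma> m) = m" "perm_exp \<sigma> (perm_exp ?\<tau> m) = m" for m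
    using assms by (metis perm_exp_comp perm_exp_id)+
  then show "perm_exp ?\<tau> \<circ> perm_exp \<sigma> = id" "perm_exp \<sigma> \<circ> perm_exp ?\<tau> = id"
    by (simp_all add: fun_eq_iff)
qed

lemma keys_perm_exp: "bij \<sigma> \<Longrightarrow> Poly_Mapping.keys (perm_exp \<sigma> m) = \<sigma> ` Poly_Mapping.keys m"
proof -
  assume b: "bij \<sigma>"
  then have "\<exists>j. k = \<sigma> j" for k
    by (metis bij_pointE)
  then show ?thesis
    using lookup_perm_exp[OF b] by (fastforce simp: in_keys_iff)
qed

lemma perm_exp_single: "bij \<sigma> \<Longrightarrow> perm_exp \<sigma> (Poly_Mapping.single j c) = Poly_Mapping.single (\<sigma> j) c"
  by (rule perm_exp_eqI) (auto simp: lookup_single when_def dest: bij_is_inj injD)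

lemma perm_exp_sum: "bij \<sigma> \<Longrightarrow> perm_exp \<sigma> (sum f A) = (\<Sum>i\<in>A. perm_exp \<sigma> (f i))"
  by (induction A rule: infinite_finite_induct) (auto simp: perm_exp_add)

lemma lookup_perm_act:
  assumes "bij \<sigma>"
  shows "Poly_Mapping.lookup (perm_act \<sigma> p) (perm_exp \<sigma> m) = Poly_Mapping.lookup p m"
proof -
  have "perm_exp \<sigma> i = perm_exp \<sigma> m \<longleftrightarrow> i = m" for i
    using bij_perm_exp[OF assms] by (auto dest: bij_is_inj injD)
  then show ?thesis
    by (auto simp: perm_act_def lookup_sum lookup_single when_def in_keys_iff)
qed

lemma perm_act_eqI:
  assumes "bij \<sigma>" "\<And>m. Poly_Mapping.lookup q (perm_exp \<sigma> m) = Poly_Mapping.lookup p m"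
  shows "perm_act \<sigma> p = q"
proof (rule poly_mapping_eqI)
  fix k
  obtain m where "k = perm_exp \<sigma> m"
    using bij_perm_exp[OF assms(1)] by (metis bij_pointE)
  then show "Poly_Mapping.lookup (perm_act \<sigma> p) k = Poly_Mapping.lookup q k"
    using assms by (simp add: lookup_perm_act)
qed

lemma perm_act_add: "bij \<sigma> \<Longrightarrow> perm_act \<sigma> (p + q) = perm_act \<sigma> p + perm_act \<sigma> q"
  by (rule perm_act_eqI) (auto simp: lookup_add lookup_perm_act)

lemma perm_act_zero [simp]: "perm_act \<sigma> 0 = 0"
  by (simp add: perm_act_def)

lemma perm_act_id [simp]: "perm_act id p = p"
  by (rule perm_act_eqI) auto

lemma perm_act_comp: "bij \<sigma> \<Longrightarrow> bij \<tau> \<Longrightarrow> perm_act (\<sigma> \<circ> \<tau>) p = perm_act \<sigma> (perm_act \<tau> p)"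
  by (rule perm_act_eqI) (auto simp: lookup_perm_act bij_comp perm_exp_comp)

lemma perm_act_single: "perm_act \<sigma> (Poly_Mapping.single m c) = Poly_Mapping.single (perm_exp \<sigma> m) c"
  by (simp add: perm_act_def)

lemma perm_act_sum: "bij \<sigma> \<Longrightarrow> perm_act \<sigma> (sum f A) = (\<Sum>i\<in>A. perm_act \<sigma> (f i))"
  by (induction A rule: infinite_finite_induct) (auto simp: perm_act_add)

lemma perm_act_mult:
  assumes "bij \<sigma>"
  shows "perm_act \<sigma> (p * q) = perm_act \<sigma> p * perm_act \<sigma> q"
proof (induction p rule: poly_mapping_single_induct)
  case (single m c)
  show ?case
    by (induction q rule: poly_mapping_single_induct)
      (auto simp: perm_act_single mult_single perm_exp_add perm_act_add assms distrib_left)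
qed (auto simp: assms perm_act_add distrib_right)

lemma perm_act_cst: "perm_act \<sigma> (cst c) = cst c"
  by (simp add: cst_def perm_act_single)

lemma perm_act_xmonom: "perm_act \<sigma> (xmonom m) = xmonom (perm_exp \<sigma> m)"
  by (simp add: xmonom_def perm_act_single)

section \<open>Constants, monomials and S as a kG-module\<close>

lemma cst_add: "cst (b + c) = cst b + cst c"
  by (simp add: cst_def single_add)

lemma cst_mult: "cst (b * c) = cst b * cst c"
  by (simp add: cst_def mult_single)

lemma cst_one [simp]: "cst 1 = 1"
  by (simp add: cst_def)

lemma cst_zero [simp]: "cst 0 = 0"
  by (simp add: cst_def)

lemma lookup_cst_mult: "Poly_Mapping.lookup (cst c * p) m = c * Poly_Mapping.lookup p m"
  by (induction p rule: poly_mapping_single_induct)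
    (auto simp: cst_def mult_single lookup_single when_def distrib_left lookup_add)

lemma cst_mult_xmonom: "cst c * xmonom m = Poly_Mapping.single m c"
  by (simp add: cst_def xmonom_def mult_single)

lemma xmonom_commute: "xmonom m * p = p * (xmonom m :: 'k::ring_1 mpol)"
  by (induction p rule: poly_mapping_single_induct)
    (auto simp: xmonom_def mult_single add.commute distrib_left distrib_right)

lemma poly_mapping_xmonom_expand:
  "p = (\<Sum>m\<in>Poly_Mapping.keys p. cst (Poly_Mapping.lookup p m) * xmonom m)"
  by (simp add: cst_mult_xmonom poly_mapping_sum_single)

lemma keys_xmonom [simp]: "Poly_Mapping.keys (xmonom m :: 'k::ring_1 mpol) = {m}"
  by (simp add: xmonom_def)

lemma poly_ring_zero: "0 \<in> poly_ring n"
  by (simp add: poly_ring_def)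

lemma poly_ring_add: "p \<in> poly_ring n \<Longrightarrow> q \<in> poly_ring n \<Longrightarrow> p + q \<in> poly_ring n"
  using keys_add[of p q] unfolding poly_ring_def by blast

lemma poly_ring_uminus: "p \<in> poly_ring n \<Longrightarrow> - p \<in> poly_ring (n :: nat)"
  for p :: "'k::ring_1 mpol"
  by (auto simp: poly_ring_def in_keys_iff)

lemma poly_ring_mult:
  assumes "p \<in> poly_ring n" "q \<in> poly_ring n"
  shows "p * q \<in> poly_ring n"
  unfolding poly_ring_def
proof (intro CollectI ballI)
  fix m assume "m \<in> Poly_Mapping.keys (p * q)"
  then obtain a b where "m = a + b" "a \<in> Poly_Mapping.keys p" "b \<in> Poly_Mapping.keys q"
    using keys_mult[of p q] by blast
  then show "Poly_Mapping.keys m \<subseteq> {1..n}"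
    using assms keys_add[of a b] unfolding poly_ring_def by blast
qed

lemma poly_ring_sum: "(\<And>i. i \<in> A \<Longrightarrow> f i \<in> poly_ring n) \<Longrightarrow> sum f A \<in> poly_ring n"
  by (induction A rule: infinite_finite_induct) (auto intro: poly_ring_zero poly_ring_add)

lemma poly_ring_cst: "cst c \<in> poly_ring n"
  by (simp add: poly_ring_def cst_def)

lemma poly_ring_xmonom: "Poly_Mapping.keys m \<subseteq> {1..n} \<Longrightarrow> xmonom m \<in> poly_ring n"
  by (simp add: poly_ring_def)

lemma poly_ring_perm_act:
  assumes "g permutes {1..n}" "p \<in> poly_ring n"
  shows "perm_act g p \<in> poly_ring n"
  unfolding poly_ring_def
proof (intro CollectI ballI)
  have b: "bij g"
    using assms(1) by (rule permutes_bij)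
  fix k assume k: "k \<in> Poly_Mapping.keys (perm_act g p)"
  obtain m where m: "k = perm_exp g m"
    using bij_perm_exp[OF b] by (metis bij_pointE)
  have "m \<in> Poly_Mapping.keys p"
    using k m lookup_perm_act[OF b] by (metis in_keys_iff)
  then have "Poly_Mapping.keys m \<subseteq> {1..n}"
    using assms(2) by (simp add: poly_ring_def)
  then show "Poly_Mapping.keys k \<subseteq> {1..n}"
    using m keys_perm_exp[OF b] permutes_image[OF assms(1)] by blast
qed

lemma kG_module_poly_module: "kG_module n (poly_module n)"
proof -
  have "comm_group (poly_module n :: ('k::ring_1 mpol, 'k) kG_mod)"
  proof (rule comm_groupI)
    fix x :: "'k mpol" assume "x \<in> carrier (poly_module n)"
    then show "\<exists>y\<in>carrier (poly_module n). y \<otimes>\<^bsub>poly_module n\<^esub> x = \<one>\<^bsub>poly_module n\<^esub>"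
      by (intro bexI[of _ "- x"]) (auto simp: poly_module_def poly_ring_uminus)
  qed (auto simp: poly_module_def poly_ring_add poly_ring_zero add_ac)
  then show ?thesis
    unfolding kG_module_def
    by (auto simp: poly_module_def poly_ring_mult poly_ring_cst poly_ring_perm_act distrib_left distrib_right
        cst_add cst_mult mult.assoc perm_act_add perm_act_mult perm_act_cst perm_act_comp permutes_bij)
qed

section \<open>Elementary symmetric polynomials\<close>

definition ind_exp :: "nat set \<Rightarrow> (nat \<Rightarrow>\<^sub>0 nat)"
  where "ind_exp A = (\<Sum>j\<in>A. Poly_Mapping.single j 1)"

lemma lookup_ind_exp: "finite A \<Longrightarrow> Poly_Mapping.lookup (ind_exp A) j = of_bool (j \<in> A)"
  by (auto simp: ind_exp_def lookup_sum lookup_single when_def)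

lemma keys_ind_exp: "finite A \<Longrightarrow> Poly_Mapping.keys (ind_exp A) = A"
  by (auto simp: in_keys_iff lookup_ind_exp split: if_splits)

lemma ind_exp_inj: "finite A \<Longrightarrow> finite B \<Longrightarrow> ind_exp A = ind_exp B \<Longrightarrow> A = B"
  by (metis keys_ind_exp)

lemma perm_exp_ind_exp:
  assumes "bij g"
  shows "perm_exp g (ind_exp A) = ind_exp (g ` A)"
proof -
  have "inj_on g A"
    using assms by (meson bij_is_inj inj_on_subset subset_UNIV)
  then show ?thesis
    by (simp add: ind_exp_def perm_exp_sum perm_exp_single assms sum.reindex)
qed

lemma esym_alt: "esym n i = (\<Sum>A\<in>{A. A \<subseteq> {1..n} \<and> card A = i}. xmonom (ind_exp A))"
  by (simp add: esym_def ind_exp_def)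

lemma finite_subsets_card: "finite {A. A \<subseteq> {1..n::nat} \<and> card A = i}"
  by (rule finite_subset[of _ "Pow {1..n}"]) auto

lemma lookup_esym:
  "Poly_Mapping.lookup (esym n i :: 'k::ring_1 mpol) m =
    of_bool (\<exists>A. A \<subseteq> {1..n} \<and> card A = i \<and> m = ind_exp A)"
proof (cases "\<exists>A. A \<subseteq> {1..n} \<and> card A = i \<and> m = ind_exp A")
  case True
  then obtain A where A: "A \<subseteq> {1..n}" "card A = i" "m = ind_exp A"
    by blast
  have "B = A" if "B \<subseteq> {1..n}" "ind_exp B = ind_exp A" for B
    using that A by (meson finite_atLeastAtMost finite_subset ind_exp_inj)
  then have "Poly_Mapping.lookup (esym n i :: 'k mpol) m = (\<Sum>B\<in>{A. A \<subseteq> {1..n} \<and> card A = i}. if B = A then 1 else 0)"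
    unfolding esym_alt lookup_sum xmonom_def lookup_single when_def A(3)
    by (intro sum.cong) auto
  also have "\<dots> = 1"
    using A finite_subsets_card by simp
  finally show ?thesis
    using True by simp
next
  case False
  then show ?thesis
    by (auto simp: esym_alt lookup_sum xmonom_def lookup_single when_def intro!: sum.neutral)
qed

lemma keys_esym:
  "Poly_Mapping.keys (esym n i :: 'k::ring_1 mpol) = ind_exp ` {A. A \<subseteq> {1..n} \<and> card A = i}"
  by (auto simp: in_keys_iff lookup_esym)

text \<open>A permutation maps the \<open>i\<close>-element subsets of \<open>{1..n}\<close>
  bijectively to themselves, so it only reorders the summands.\<close>

lemma perm_act_esym:
  assumes "g permutes {1..n}"
  shows "perm_act g (esym n i) = esym n i"
proof -
  have b: "bij g"
    using assms by (rule permutes_bij)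
  have 1: "card (g ` A) = card A" for A
    using b by (meson bij_is_inj card_image inj_on_subset subset_UNIV)
  let ?S = "{A. A \<subseteq> {1..n} \<and> card A = i}"
  have 2: "(`) g ` ?S \<subseteq> ?S"
    using permutes_in_image[OF assms] 1 by force
  have 3: "inj_on ((`) g) ?S"
    using inj_image_eq_iff[OF bij_is_inj[OF b]] by (intro inj_onI) blast
  have "bij_betw ((`) g) ?S ?S"
    using endo_inj_surj[OF finite_subsets_card 2 3] 3 by (simp add: bij_betw_def)
  then show ?thesis
    by (simp add: esym_alt perm_act_sum b perm_act_xmonom perm_exp_ind_exp sum.reindex_bij_betw[of _ _ _ "\<lambda>A. xmonom (ind_exp A)"])
qed

text \<open>All coefficients are 1, so \<open>esym n i\<close> is central even if \<open>k\<close>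
  is not commutative.\<close>

lemma esym_commute: "esym n i * p = p * (esym n i :: 'k::ring_1 mpol)"
  by (simp add: esym_alt sum_distrib_left sum_distrib_right xmonom_commute)

lemma poly_ring_esym: "esym n i \<in> poly_ring n"
  unfolding esym_alt
  by (intro poly_ring_sum poly_ring_xmonom) (simp add: keys_ind_exp finite_subset[of _ "{1..n}"])

section \<open>Products d_M over multisets and additive generators of k[d_I]\<close>

definition dprod :: "nat \<Rightarrow> nat multiset \<Rightarrow> 'k::ring_1 mpol"
  where "dprod n M = fold_mset (\<lambda>i p. esym n i * p) 1 M"

lemma dprod_empty [simp]: "dprod n {#} = 1"
  by (simp add: dprod_def)

text \<open>The fold over a multiset is independent of the order because the factors are
  central.\<close>

lemma dprod_add_mset [simp]: "dprod n (add_mset i M) = esym n i * (dprod n M :: 'k::ring_1 mpol)"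
proof -
  interpret comp_fun_commute "\<lambda>i p. esym n i * p :: 'k mpol"
    by unfold_locales (simp add: fun_eq_iff, metis mult.assoc esym_commute)
  show ?thesis
    by (simp add: dprod_def)
qed

lemma dprod_union: "dprod n (M + N) = dprod n M * dprod n N"
  by (induction M) (auto simp: mult.assoc)

lemma dprod_commute: "dprod n M * p = p * dprod n M"
proof (induction M)
  case (add i M)
  have "dprod n (add_mset i M) * p = esym n i * (p * dprod n M)"
    by (simp add: mult.assoc add)
  also have "\<dots> = p * (esym n i * dprod n M)"
    by (metis mult.assoc esym_commute)
  finally show ?case
    by simp
qed simp

lemma poly_ring_dprod: "dprod n M \<in> poly_ring n"
  by (induction M) (auto intro: poly_ring_mult poly_ring_esym poly_ring_cst[of 1, simplified])

lemma perm_act_dprod: "g permutes {1..n} \<Longrightarrow> perm_act g (dprod n M) = dprod n M"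
  by (induction M) (use perm_act_cst[of g 1] in \<open>auto simp: perm_act_mult permutes_bij perm_act_esym\<close>)

lemma esym_prod_eq_dprod: "esym_prod n I = (dprod n (mset_set I) :: 'k::ring_1 mpol)"
proof (cases "finite I")
  case True
  have "prod_list (map (esym n) xs) = (dprod n (mset xs) :: 'k mpol)" for xs
    by (induction xs) auto
  moreover have "mset (sorted_list_of_set I) = mset_set I"
    by (metis mset_sorted_list_of_multiset sorted_list_of_mset_set)
  ultimately show ?thesis
    by (simp add: esym_prod_def)
qed (simp add: esym_prod_def)

text \<open>Centrality of d_M gives (c d_M)(c' d_N) = (c c') d_{M+N}, so the generators on the right
  are closed under multiplication.\<close>

lemma esym_subring_eq_add_span:
  "(esym_subring n I :: 'k::ring_1 mpol set) = add_span {cst c * dprod n M |c M. set_mset M \<subseteq> I}" (is "_ = add_span ?X")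
proof (intro equalityI subsetI)
  fix p :: "'k mpol"
  assume "p \<in> esym_subring n I"
  then show "p \<in> add_span ?X"
  proof induction
    case (cst c)
    show ?case
      by (rule add_span.base) (use dprod_empty in \<open>force intro!: exI[of _ c] exI[of _ "{#}"]\<close>)
  next
    case (gen i)
    then show ?case
      by (intro add_span.base CollectI exI[of _ 1] exI[of _ "{#i#}"]) auto
  next
    case (mult p q)
    have *: "cst c * dprod n M * q \<in> add_span ?X" if "set_mset M \<subseteq> I" for c M
      using mult(4)
    proof induction
      case (base x)
      then obtain d N where x: "x = cst d * dprod n N" "set_mset N \<subseteq> I"
        by blast
      have "dprod n M * (cst d * dprod n N) = cst d * dprod n (M + N)"
        by (simp only: mult.assoc[symmetric] dprod_union dprod_commute[of n M "cst d"])
      then have "cst c * dprod n M * x = cst (c * d) * dprod n (M + N)"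
        by (simp add: x cst_mult mult.assoc)
      then show ?case
        using that x(2) by (auto intro!: add_span.base exI[of _ "c * d"] exI[of _ "M + N"])
    qed (auto simp: distrib_left intro: add_span.intros)
    from mult(3) show ?case
      by induction (use * in \<open>auto simp: distrib_right intro: add_span.intros\<close>)
  qed (auto intro: add_span.intros)
next
  fix p :: "'k mpol"
  assume "p \<in> add_span ?X"
  then show "p \<in> esym_subring n I"
  proof induction
    case zero
    then show ?case
      using esym_subring.cst[of 0] by simp
  next
    case (base x)
    then obtain c M where x: "x = cst c * dprod n M" "set_mset M \<subseteq> I"
      by blast
    have "set_mset M \<subseteq> I \<Longrightarrow> dprod n M \<in> (esym_subring n I :: 'k mpol set)"
      by (induction M) (use esym_subring.cst[of 1] in \<open>auto intro: esym_subring.intros\<close>)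
    then show ?case
      using x by (auto intro: esym_subring.intros)
  qed (auto intro: esym_subring.intros)
qed

section \<open>Submodules generated by monomials\<close>

lemma kG_submodule_kG_span: "E \<subseteq> poly_ring n \<Longrightarrow> kG_submodule n (kG_span n E)"
proof -
  assume E: "E \<subseteq> poly_ring n"
  \<comment> \<open>This makes the family of submodules containing \<open>E\<close> nonempty; the
    intersection of an empty family would be the whole type.\<close>
  have "kG_submodule n (poly_ring n :: 'k::ring_1 mpol set)"
    by (simp add: kG_submodule_def poly_ring_zero poly_ring_add poly_ring_mult poly_ring_cst poly_ring_perm_act)
  then have "kG_span n E \<subseteq> poly_ring n"
    using E by (auto simp: kG_span_def)
  then show ?thesis
    unfolding kG_submodule_def by (fastforce simp: kG_span_def kG_submodule_def)
qed

text \<open>The group fixes constants and moves one monomial of the orbit to another, so the left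
  multiples of the orbit already span a submodule.\<close>

lemma kG_span_xmonom_eq_add_span:
  assumes "Poly_Mapping.keys e \<subseteq> {1..n}"
  shows "kG_span n {xmonom e :: 'k::ring_1 mpol} = add_span {cst c * xmonom (perm_exp g e) |c g. g permutes {1..n}}" (is "_ = add_span ?X")
proof (rule equalityI)
  have p: "kG_submodule n (kG_span n {xmonom e :: 'k mpol})"
    using poly_ring_xmonom[OF assms] by (intro kG_submodule_kG_span) blast
  have i: "xmonom e \<in> kG_span n {xmonom e :: 'k mpol}"
    by (auto simp: kG_span_def)
  have "x \<in> kG_span n {xmonom e}" if "x \<in> add_span ?X" for x :: "'k mpol"
    using that
  proof induction
    case (base x)
    then obtain c g where x: "x = cst c * xmonom (perm_exp g e)" "g permutes {1..n}"
      by blast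
    then have "perm_act g (xmonom e) \<in> kG_span n {xmonom e :: 'k mpol}"
      using p i by (simp add: kG_submodule_def)
    then show ?case
      using p x by (simp add: perm_act_xmonom kG_submodule_def)
  qed (use p in \<open>auto simp: kG_submodule_def\<close>)
  then show "add_span ?X \<subseteq> kG_span n {xmonom e :: 'k mpol}"
    by blast
  have "kG_submodule n (add_span ?X)"
    unfolding kG_submodule_def
  proof (intro conjI ballI allI impI)
    show "add_span ?X \<subseteq> poly_ring n"
    proof
      fix x :: "'k mpol" assume "x \<in> add_span ?X"
      then show "x \<in> poly_ring n"
      proof induction
        case (base x)
        then obtain c g where x: "x = cst c * xmonom (perm_exp g e)" "g permutes {1..n}"
          by blast
        have "perm_act g (xmonom e :: 'k mpol) \<in> poly_ring n"
          using x assms by (intro poly_ring_perm_act poly_ring_xmonom)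
        then show ?case
          using x by (simp add: perm_act_xmonom poly_ring_mult poly_ring_cst)
      qed (auto intro: poly_ring_zero poly_ring_add)
    qed
  next
    fix c :: 'k and x assume "x \<in> add_span ?X"
    then show "cst c * x \<in> add_span ?X"
    proof induction
      case (base x)
      then obtain d g where x: "x = cst d * xmonom (perm_exp g e)" "g permutes {1..n}"
        by blast
      then have "cst c * x = cst (c * d) * xmonom (perm_exp g e)"
        by (simp add: mult.assoc cst_mult)
      then show ?case
        using x(2) by (intro add_span.base) blast
    qed (simp_all add: distrib_left add_span.zero add_span.add)
  next
    fix h :: "nat \<Rightarrow> nat" and x :: "'k mpol" assume h: "h permutes {1..n}" and "x \<in> add_span ?X"
    from this(2) show "perm_act h x \<in> add_span ?X"
    proof induction
      case (base x)
      then obtain c g where x: "x = cst c * xmonom (perm_exp g e)" "g permutes {1..n}"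
        by blast
      then have "perm_act h x = cst c * xmonom (perm_exp (h \<circ> g) e)"
        using h by (simp add: perm_act_mult permutes_bij perm_act_cst perm_act_xmonom perm_exp_comp)
      then show ?case
        using permutes_compose[OF x(2) h] by (intro add_span.base) blast
    qed (simp_all add: perm_act_add permutes_bij[OF h] add_span.zero add_span.add)
  qed (simp_all add: add_span.zero add_span.add)
  moreover have "xmonom e \<in> add_span ?X"
    by (intro add_span.base CollectI exI[of _ 1] exI[of _ id]) (auto simp: permutes_id)
  ultimately show "kG_span n {xmonom e} \<subseteq> add_span ?X"
    by (auto simp: kG_span_def)
qed

section \<open>Leading exponents\<close>

text \<open>At most the pair \<open>(a0, b0)\<close> contributes to this coefficient. Uniqueness of
  the decomposition replaces a monomial order, and the product of the two coefficients may well be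
  0.\<close>

lemma lookup_mult_unique:
  fixes p q :: "'k::ring_1 mpol"
  assumes "\<And>a b. \<lbrakk>a \<in> Poly_Mapping.keys p; b \<in> Poly_Mapping.keys q; a + b = a0 + b0\<rbrakk> \<Longrightarrow> a = a0 \<and> b = b0"
  shows "Poly_Mapping.lookup (p * q) (a0 + b0) = Poly_Mapping.lookup p a0 * Poly_Mapping.lookup q b0"
proof -
  let ?l = "Poly_Mapping.lookup"
  let ?P = "Poly_Mapping.keys p" and ?Q = "Poly_Mapping.keys q"
  have "p * q = (\<Sum>a\<in>?P. Poly_Mapping.single a (?l p a)) * (\<Sum>b\<in>?Q. Poly_Mapping.single b (?l q b))"
    by (simp add: poly_mapping_sum_single)
  also have "\<dots> = (\<Sum>a\<in>?P. \<Sum>b\<in>?Q. Poly_Mapping.single (a + b) (?l p a * ?l q b))"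
    by (simp add: sum_product mult_single)
  finally have "?l (p * q) (a0 + b0) = (\<Sum>a\<in>?P. \<Sum>b\<in>?Q. ?l p a * ?l q b when a + b = a0 + b0)"
    by (simp add: lookup_sum lookup_single)
  also have "\<dots> = (\<Sum>a\<in>?P. \<Sum>b\<in>?Q. if a = a0 then (if b = b0 then ?l p a * ?l q b else 0) else 0)"
    using assms by (intro sum.cong refl) (auto simp: when_def)
  also have "\<dots> = (\<Sum>a\<in>?P. if a = a0 then (\<Sum>b\<in>?Q. if b = b0 then ?l p a * ?l q b else 0) else 0)"
    by (intro sum.cong refl) auto
  also have "\<dots> = ?l p a0 * ?l q b0"
    by (auto simp: sum.delta' in_keys_iff)
  finally show ?thesis .
qed

text \<open>The partition conjugate to \<open>S\<close>.\<close>

definition lam :: "nat multiset \<Rightarrow> (nat \<Rightarrow>\<^sub>0 nat)"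
  where "lam S = (\<Sum>i\<in>#S. ind_exp {1..i})"

lemma lam_empty [simp]: "lam {#} = 0"
  by (simp add: lam_def)

lemma lam_add_mset [simp]: "lam (add_mset i S) = ind_exp {1..i} + lam S"
  by (simp add: lam_def)

lemma lam_union: "lam (S + T) = lam S + lam T"
  by (simp add: lam_def)

text \<open>The two indicators first differ at the least element of \<open>{1..card A}\<close>
  missing from \<open>A\<close>, and there the initial segment has the larger entry.\<close>

lemma ind_exp_le_initial:
  assumes "A \<subseteq> {1..n}"
  shows "ind_exp A \<le> ind_exp {1..card A}"
proof (cases "A = {1..card A}")
  case False
  have fin: "finite A"
    using assms finite_subset by blast
  have "{1..card A} - A \<noteq> {}"
    using False fin card_subset_eq[of A "{1..card A}"] by auto
  define k where "k = Min ({1..card A} - A)"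
  have k: "k \<in> {1..card A} - A"
    unfolding k_def using \<open>{1..card A} - A \<noteq> {}\<close> by (intro Min_in) auto
  have "k' \<in> A \<longleftrightarrow> k' \<in> {1..card A}" if "k' < k" for k'
  proof -
    have "k' \<notin> {1..card A} - A"
      using that Min_le[of "{1..card A} - A" k'] unfolding k_def by fastforce
    then show ?thesis
      using that k assms by auto
  qed
  then have "\<exists>k. Poly_Mapping.lookup (ind_exp A) k < Poly_Mapping.lookup (ind_exp {1..card A}) k \<and>
      (\<forall>k'<k. Poly_Mapping.lookup (ind_exp A) k' = Poly_Mapping.lookup (ind_exp {1..card A}) k')"
    using k fin by (intro exI[of _ k]) (auto simp: lookup_ind_exp)
  then have "ind_exp A < ind_exp {1..card A}"
    by (simp add: less_poly_mapping.rep_eq less_fun_def)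
  then show ?thesis
    by simp
qed simp

text \<open>The order is compatible with addition, so the maximal exponent of a product arises from
  the two maximal exponents only. The result serves twice: it computes \<open>e_gen\<close>, and its
  coefficient 1 becomes the diagonal entry of the unitriangular system.\<close>

lemma dprod_lex_lead:
  assumes "set_mset M \<subseteq> {1..n}"
  shows "(\<forall>w\<in>Poly_Mapping.keys (dprod n M :: 'k::ring_1 mpol). w \<le> lam M) \<and>
    Poly_Mapping.lookup (dprod n M :: 'k mpol) (lam M) = 1"
  using assms
proof (induction M)
  case (add i M)
  let ?e = "esym n i :: 'k mpol" and ?d = "dprod n M :: 'k mpol"
  have 1: "a \<le> ind_exp {1..i}" if "a \<in> Poly_Mapping.keys ?e" for a
    using that ind_exp_le_initial by (auto simp: keys_esym)
  have 2: "b \<le> lam M" if "b \<in> Poly_Mapping.keys ?d" for b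
    using that add by auto
  have "w \<le> ind_exp {1..i} + lam M" if "w \<in> Poly_Mapping.keys (?e * ?d)" for w
    using that keys_mult[of ?e ?d] 1 2 by (auto intro: add_mono)
  moreover have "Poly_Mapping.lookup (?e * ?d) (ind_exp {1..i} + lam M) =
    Poly_Mapping.lookup ?e (ind_exp {1..i}) * Poly_Mapping.lookup ?d (lam M)"
  proof (rule lookup_mult_unique)
    fix a b assume a: "a \<in> Poly_Mapping.keys ?e" "b \<in> Poly_Mapping.keys ?d" "a + b = ind_exp {1..i} + lam M"
    show "a = ind_exp {1..i} \<and> b = lam M"
    proof (rule ccontr)
      assume "\<not> ?thesis"
      then have "a + b < ind_exp {1..i} + lam M"
        using 1[OF a(1)] 2[OF a(2)] by (metis add_le_less_mono add_less_le_mono order.not_eq_order_implies_strict)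
      then show False
        using a(3) by simp
    qed
  qed
  moreover have "Poly_Mapping.lookup ?e (ind_exp {1..i}) = 1"
    using add.prems by (auto simp: lookup_esym intro!: exI[of _ "{1..i}"])
  ultimately show ?case
    using add by simp
qed (simp add: lookup_one)

lemma lex_lead_exp_dprod:
  assumes "set_mset M \<subseteq> {1..n}"
  shows "lex_lead_exp (dprod n M :: 'k::ring_1 mpol) = lam M"
  unfolding lex_lead_exp_def
  using dprod_lex_lead[OF assms, where 'k = 'k] by (intro Max_eqI) (auto simp: in_keys_iff)

definition e_exp :: "nat \<Rightarrow> nat set \<Rightarrow> (nat \<Rightarrow>\<^sub>0 nat)"
  where "e_exp n I = lam (mset_set (I - {n}))"

lemma e_gen_eq:
  assumes "n \<in> I" "I \<subseteq> {1..n}"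
  shows "(e_gen n I :: 'k::ring_1 mpol) = xmonom (e_exp n I)"
proof -
  have fin: "finite I" and "n \<ge> 1"
    using assms finite_subset by auto
  then have I: "mset_set I = add_mset n (mset_set (I - {n}))"
    using assms by (metis mset_set.remove)
  have "lex_lead_exp (esym n n :: 'k mpol) = ind_exp {1..n}"
    using lex_lead_exp_dprod[of "{#n#}" n, where 'k = 'k] assms by auto
  moreover have "lex_lead_exp (esym_prod n I :: 'k mpol) = ind_exp {1..n} + e_exp n I"
    using lex_lead_exp_dprod[of "mset_set I" n, where 'k = 'k] assms fin I \<open>n \<ge> 1\<close>
    by (simp add: esym_prod_eq_dprod e_exp_def del: dprod_add_mset)
  ultimately show ?thesis
    by (simp add: e_gen_def)
qed

section \<open>The sum of squares of the exponents\<close>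

definition exp_on :: "(nat \<Rightarrow>\<^sub>0 nat) \<Rightarrow> nat set \<Rightarrow> nat"
  where "exp_on u A = (\<Sum>j\<in>A. Poly_Mapping.lookup u j)"

definition sumsq :: "nat \<Rightarrow> (nat \<Rightarrow>\<^sub>0 nat) \<Rightarrow> nat"
  where "sumsq n u = (\<Sum>j\<in>{1..n}. (Poly_Mapping.lookup u j)\<^sup>2)"

lemma exp_on_zero [simp]: "exp_on 0 A = 0"
  by (simp add: exp_on_def)

lemma exp_on_add: "exp_on (u + v) A = exp_on u A + exp_on v A"
  by (simp add: exp_on_def lookup_add sum.distrib)

lemma exp_on_ind_exp: "finite A \<Longrightarrow> finite B \<Longrightarrow> exp_on (ind_exp B) A = card (A \<inter> B)"
  by (simp add: exp_on_def lookup_ind_exp Int_def flip: sum.inter_filter)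

text \<open>Expand (w_j + 1)^2 for j in \<open>A\<close>. For fixed \<open>w\<close> and
  \<open>card A\<close>, only the mixed term \<open>exp_on w A\<close> depends on the position of
  \<open>A\<close>.\<close>

lemma sumsq_add_ind_exp:
  assumes "A \<subseteq> {1..n}"
  shows "sumsq n (ind_exp A + w) = card A + 2 * exp_on w A + sumsq n w"
proof -
  have fin: "finite A"
    using assms finite_subset by blast
  have "sumsq n (ind_exp A + w) =
    (\<Sum>j\<in>{1..n}. (if j \<in> A then 1 + 2 * Poly_Mapping.lookup w j else 0) + (Poly_Mapping.lookup w j)\<^sup>2)"
    unfolding sumsq_def using fin
    by (intro sum.cong) (auto simp: lookup_add lookup_ind_exp power2_eq_square algebra_simps)
  also have "\<dots> = (\<Sum>j\<in>{1..n} \<inter> A. 1 + 2 * Poly_Mapping.lookup w j) + sumsq n w"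
    by (subst sum.distrib) (simp only: sumsq_def sum.inter_restrict[OF finite_atLeastAtMost])
  also have "{1..n} \<inter> A = A"
    using assms by blast
  finally show ?thesis
    by (simp only: sum.distrib exp_on_def) (simp add: sum_distrib_left)
qed

lemma sumsq_perm_exp:
  assumes "g permutes {1..n}"
  shows "sumsq n (perm_exp g u) = sumsq n u"
proof -
  have "sumsq n (perm_exp g u) = (\<Sum>j\<in>{1..n}. (Poly_Mapping.lookup (perm_exp g u) (g j))\<^sup>2)"
    unfolding sumsq_def using permutes_imp_bij[OF assms] by (intro sum.reindex_bij_betw[symmetric])
  then show ?thesis
    using assms by (simp add: lookup_perm_exp permutes_bij sumsq_def)
qed

text \<open>Among the sets of positions of a given size, an initial segment meets every
  \<open>{1..i}\<close> in the most elements, so the bound holds summand by summand.\<close>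

lemma exp_on_lam_le:
  assumes "finite A"
  shows "exp_on (lam S) A \<le> exp_on (lam S) {1..card A}"
proof (induction S)
  case (add i S)
  have "card (A \<inter> {1..i}) \<le> card ({1..card A} \<inter> {1..i})"
    using assms card_mono[of A "A \<inter> {1..i}"] card_mono[of "{1..i}" "A \<inter> {1..i}"] by simp
  then show ?case
    using add assms by (simp add: exp_on_add exp_on_ind_exp del: min.bounded_iff)
qed simp

text \<open>Since \<open>card A\<close> occurs in \<open>S\<close>, the summand
  \<open>ind_exp {1..card A}\<close> is present, and \<open>A\<close> meets that segment in fewer
  than \<open>card A\<close> points. The other summands only help.\<close>

lemma exp_on_lam_less:
  assumes "finite A" "card A \<in># S" "A \<noteq> {1..card A}"
  shows "exp_on (lam S) A < exp_on (lam S) {1..card A}"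
proof -
  obtain S' where S: "S = add_mset (card A) S'"
    using assms(2) by (meson mset_add)
  have "card (A \<inter> {1..card A}) < card A"
  proof (rule psubset_card_mono[OF assms(1)])
    have "A \<inter> {1..card A} \<noteq> A"
      using card_subset_eq[of "{1..card A}" A] assms(3) by (auto simp: Int_absorb2)
    then show "A \<inter> {1..card A} \<subset> A"
      by blast
  qed
  then show ?thesis
    using exp_on_lam_le[OF assms(1), of S'] assms(1) by (simp add: S exp_on_add exp_on_ind_exp)
qed

text \<open>
  The bound on \<open>exp_on w A\<close> is what makes the induction work: it controls the mixed term when
  \<open>w\<close> is increased by an indicator vector.
\<close>

lemma dprod_xmonom_sumsq:
  assumes "I \<subseteq> {1..n}" "set_mset M \<subseteq> I" "w \<in> Poly_Mapping.keys (dprod n M * xmonom (e_exp n I) :: 'k::ring_1 mpol)"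
  shows "(\<forall>A\<subseteq>{1..n}. exp_on w A \<le> exp_on (e_exp n I + lam M) {1..card A}) \<and>
    (w = e_exp n I + lam M \<or> sumsq n w < sumsq n (e_exp n I + lam M))"
  using assms(2,3)
proof (induction M arbitrary: w)
  case empty
  then show ?case
    using exp_on_lam_le[of _ "mset_set (I - {n})"] finite_subset[of _ "{1..n}"] by (auto simp: e_exp_def)
next
  case (add i M)
  let ?L = "e_exp n I + lam M"
  have i: "i \<in> I" "i \<in> {1..n}" and M: "set_mset M \<subseteq> I"
    using add.prems assms(1) by auto
  have "w \<in> Poly_Mapping.keys (esym n i * (dprod n M * xmonom (e_exp n I)) :: 'k mpol)"
    using add.prems by (simp add: mult.assoc)
  then obtain B v where w: "w = ind_exp B + v" and v: "v \<in> Poly_Mapping.keys (dprod n M * xmonom (e_exp n I) :: 'k mpol)"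
    and B: "B \<subseteq> {1..n}" "card B = i"
    using keys_mult[of "esym n i" "dprod n M * xmonom (e_exp n I) :: 'k mpol"] unfolding keys_esym by blast
  have finB: "finite B"
    using B finite_subset by blast
  note IH = add.IH[OF M v]
  have eq: "e_exp n I + lam (add_mset i M) = ind_exp {1..i} + ?L"
    by (simp add: ac_simps)
  have "exp_on w A \<le> exp_on (ind_exp {1..i} + ?L) {1..card A}" if A: "A \<subseteq> {1..n}" for A
  proof -
    have finA: "finite A"
      using A finite_subset by blast
    have "card (A \<inter> B) \<le> min (card A) i"
      using finA finB B card_mono[of A "A \<inter> B"] card_mono[of B "A \<inter> B"] by simp
    moreover have "exp_on v A \<le> exp_on ?L {1..card A}"
      using IH A by blast
    moreover have "exp_on w A = card (A \<inter> B) + exp_on v A"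
      using finA finB by (simp add: w exp_on_add exp_on_ind_exp)
    moreover have "exp_on (ind_exp {1..i} + ?L) {1..card A} = min (card A) i + exp_on ?L {1..card A}"
      by (simp only: exp_on_add) (simp add: exp_on_ind_exp)
    ultimately show ?thesis
      by linarith
  qed
  moreover have "w = ind_exp {1..i} + ?L \<or> sumsq n w < sumsq n (ind_exp {1..i} + ?L)"
  proof -
    have l: "sumsq n (ind_exp {1..i} + ?L) = i + 2 * exp_on ?L {1..i} + sumsq n ?L"
      using i sumsq_add_ind_exp[of "{1..i}" n ?L] by simp
    have r: "sumsq n w = i + 2 * exp_on v B + sumsq n v"
      using B sumsq_add_ind_exp[of B n v] by (simp add: w)
    have le: "exp_on v B \<le> exp_on ?L {1..i}"
      using IH B by auto
    \<comment> \<open>If \<open>v\<close> is the top exponent, strictness comes from the choice of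
      \<open>B\<close>; otherwise it comes from \<open>v\<close>, and the weak bound on the mixed
      term suffices.\<close>
    show ?thesis
    proof (cases "v = ?L")
      case True
      have "exp_on ?L B < exp_on ?L {1..i}" if "B \<noteq> {1..i}"
      proof -
        \<comment> \<open>\<open>e_exp n I\<close> records only \<open>I - {n}\<close>, so the index
          \<open>n\<close> is treated separately: the only subset of \<open>{1..n}\<close> of size
          \<open>n\<close> is \<open>{1..n}\<close> itself.\<close>
        have "i \<noteq> n"
          using that B card_subset_eq[of "{1..n}" B] by auto
        then have "i \<in># mset_set (I - {n}) + M"
          using i finite_subset[OF assms(1)] by simp
        then show ?thesis
          using exp_on_lam_less[of B "mset_set (I - {n}) + M"] finB B that by (simp add: e_exp_def lam_union)
      qed
      then show ?thesis
        using True l r w by auto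
    next
      case False
      then have "sumsq n v < sumsq n ?L"
        using IH by blast
      then show ?thesis
        using l r le by linarith
    qed
  qed
  ultimately show ?case
    unfolding eq by blast
qed

section \<open>Exponent vectors and packed exponent vectors\<close>

definition orbit :: "nat \<Rightarrow> nat set \<Rightarrow> (nat \<Rightarrow>\<^sub>0 nat) set"
  where "orbit n I = {perm_exp g (e_exp n I) |g. g permutes {1..n}}"

text \<open>
  The triple \<open>(I, M, m)\<close> stands for the tensor of \<open>\<Prod>\<^bsub>i\<in>M\<^esub> d\<^sub>i\<close> and \<open>x\<^sup>m\<close> in the summand \<open>I\<close>.
\<close>

definition idx :: "nat \<Rightarrow> (nat set \<times> nat multiset \<times> (nat \<Rightarrow>\<^sub>0 nat)) set"
  where "idx n = {(I, M, m). n \<in> I \<and> I \<subseteq> {1..n} \<and> set_mset M \<subseteq> I \<and> m \<in> orbit n I}"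

definition bas :: "nat \<Rightarrow> nat multiset \<times> (nat \<Rightarrow>\<^sub>0 nat) \<Rightarrow> 'k::ring_1 mpol"
  where "bas n z = dprod n (fst z) * xmonom (snd z)"

text \<open>A relation rather than a function, since the permutation carrying
  \<open>e_exp n I\<close> to the given monomial is in general not unique.\<close>

definition lead :: "nat \<Rightarrow> nat set \<times> nat multiset \<times> (nat \<Rightarrow>\<^sub>0 nat) \<Rightarrow> (nat \<Rightarrow>\<^sub>0 nat) \<Rightarrow> bool"
  where "lead n t u \<longleftrightarrow> (\<exists>g. g permutes {1..n} \<and> snd (snd t) = perm_exp g (e_exp n (fst t)) \<and>
    u = perm_exp g (e_exp n (fst t) + lam (fst (snd t))))"

lemma ex_lead: "t \<in> idx n \<Longrightarrow> \<exists>u. lead n t u"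
  by (auto simp: idx_def lead_def orbit_def)

text \<open>The lexicographic order supplies the coefficient 1, the sum of squares the strict
  maximality. As d_M is invariant, \<open>g\<close> carries both from the sorted monomial
  \<open>e_exp n I\<close> to any monomial of its orbit.\<close>

lemma lead_bas:
  assumes "t \<in> idx n" "lead n t u"
  shows "Poly_Mapping.lookup (bas n (snd t) :: 'k::ring_1 mpol) u = 1"
    and "w \<in> Poly_Mapping.keys (bas n (snd t) :: 'k mpol) \<Longrightarrow> w = u \<or> sumsq n w < sumsq n u"
proof -
  obtain I M m where t: "t = (I, M, m)"
    by (cases t) auto
  have I: "n \<in> I" "I \<subseteq> {1..n}" "set_mset M \<subseteq> I"
    using assms(1) by (auto simp: t idx_def)
  obtain g where g: "g permutes {1..n}" "m = perm_exp g (e_exp n I)" "u = perm_exp g (e_exp n I + lam M)"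
    using assms(2) by (auto simp: t lead_def)
  note b = permutes_bij[OF g(1)]
  let ?p = "dprod n M * xmonom (e_exp n I) :: 'k mpol"
  have bas: "bas n (snd t) = perm_act g ?p"
    by (simp add: t bas_def perm_act_mult[OF b] perm_act_dprod[OF g(1)] perm_act_xmonom g(2))
  have "Poly_Mapping.lookup ?p (lam M + e_exp n I) = 1"
    using dprod_lex_lead[of M n, where 'k = 'k] I
    by (subst lookup_mult_unique) (auto simp: xmonom_def)
  then show "Poly_Mapping.lookup (bas n (snd t) :: 'k mpol) u = 1"
    by (simp add: bas g(3) lookup_perm_act[OF b] add.commute)
  assume w: "w \<in> Poly_Mapping.keys (bas n (snd t) :: 'k mpol)"
  obtain v where v: "w = perm_exp g v"
    using bij_perm_exp[OF b] by (metis bij_pointE)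
  then have "v \<in> Poly_Mapping.keys ?p"
    using w by (simp add: bas in_keys_iff lookup_perm_act[OF b])
  from dprod_xmonom_sumsq[OF I(2,3) this] show "w = u \<or> sumsq n w < sumsq n u"
    using v g(3) by (auto simp: sumsq_perm_exp[OF g(1)])
qed

section \<open>Recovering a triple from its leading exponent\<close>

lemma lookup_lam_Suc:
  assumes "j \<ge> 1"
  shows "Poly_Mapping.lookup (lam S) j = Poly_Mapping.lookup (lam S) (Suc j) + count S j"
  using assms by (induction S) (auto simp: lookup_add lookup_ind_exp)

lemma lookup_lam_zero: "Poly_Mapping.lookup (lam S) 0 = 0"
  by (induction S) (auto simp: lookup_add lookup_ind_exp)

lemma lookup_lam_antimono:
  assumes "1 \<le> j" "j \<le> k"
  shows "Poly_Mapping.lookup (lam S) k \<le> Poly_Mapping.lookup (lam S) j"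
  using assms(2)
proof (induction k rule: dec_induct)
  case (step k)
  then show ?case
    using assms(1) lookup_lam_Suc[of k S] by simp
qed simp

text \<open>Multiplicities are the drops between consecutive entries of the conjugate partition. An
  element 0 contributes an empty indicator and is invisible in \<open>lam\<close>, hence the side
  conditions.\<close>

lemma lam_inj:
  assumes "lam S = lam T" "0 \<notin># S" "0 \<notin># T"
  shows "S = T"
proof (rule multiset_eqI)
  fix j
  show "count S j = count T j"
    using assms lookup_lam_Suc[of j S] lookup_lam_Suc[of j T]
    by (cases "j = 0") (auto simp: not_in_iff)
qed

lemma keys_lam:
  assumes "set_mset S \<subseteq> {1..n}"
  shows "Poly_Mapping.keys (lam S) \<subseteq> {1..n}"
  using assms
proof (induction S)
  case (add i S)
  then show ?case
    using keys_add[of "ind_exp {1..i}" "lam S"] by (fastforce simp: keys_ind_exp)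
qed simp

lemma exp_on_perm_exp:
  assumes "bij g"
  shows "exp_on (perm_exp g u) (g ` A) = exp_on u A"
proof -
  have "inj_on g A"
    using assms by (meson bij_is_inj inj_on_subset subset_UNIV)
  then show ?thesis
    by (simp add: exp_on_def sum.reindex lookup_perm_exp assms)
qed

text \<open>The sum of the first \<open>j\<close> entries of a partition is the largest sum over
  \<open>j\<close> positions, which does not depend on the arrangement. Equal partial sums then give
  equal entries.\<close>

lemma perm_exp_lam_eq:
  assumes "bij k" "perm_exp k (lam S) = lam T"
  shows "lam S = lam T"
proof -
  have le: "exp_on (lam S) {1..j} \<le> exp_on (lam T) {1..j}" if "bij k" "perm_exp k (lam S) = lam T" for S T k j
  proof -
    have "exp_on (lam S) {1..j} = exp_on (lam T) (k ` {1..j})"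
      using that by (metis exp_on_perm_exp)
    also have "card (k ` {1..j}) = j"
      using that(1) card_image[of k "{1..j}"] by (simp add: bij_is_inj inj_on_subset[of k UNIV])
    then have "exp_on (lam T) (k ` {1..j}) \<le> exp_on (lam T) {1..j}"
      using exp_on_lam_le[of "k ` {1..j}" T] by simp
    finally show ?thesis .
  qed
  let ?k = "inv_into UNIV k"
  have "perm_exp ?k (lam T) = lam S"
    using assms(1) by (simp add: assms(2)[symmetric] perm_exp_comp[symmetric] bij_imp_bij_inv bij_is_inj)
  then have eq: "exp_on (lam S) {1..j} = exp_on (lam T) {1..j}" for j
    using le[OF assms] le[of ?k T S] assms(1) by (simp add: bij_imp_bij_inv order_antisym)
  show ?thesis
  proof (rule poly_mapping_eqI)
    fix j
    show "Poly_Mapping.lookup (lam S) j = Poly_Mapping.lookup (lam T) j"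
    proof (cases j)
      case (Suc i)
      then show ?thesis
        using eq[of i] eq[of j] by (simp add: exp_on_def)
    qed (simp add: lookup_lam_zero)
  qed
qed

text \<open>Sorting \<open>u\<close> yields the multiset \<open>(I - {n}) + M\<close>, and its
  support together with \<open>n\<close> is \<open>I\<close>, because \<open>M\<close> is supported
  on \<open>I\<close>. What remains is to recover \<open>m\<close>.\<close>

lemma lead_inj:
  assumes "t \<in> idx n" "t' \<in> idx n" "lead n t u" "lead n t' u"
  shows "t = t'"
proof -
  obtain I M m I' M' m' where t: "t = (I, M, m)" "t' = (I', M', m')"
    by (cases t, cases t') auto
  have I: "n \<in> I" "I \<subseteq> {1..n}" "set_mset M \<subseteq> I" "n \<in> I'" "I' \<subseteq> {1..n}" "set_mset M' \<subseteq> I'"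
    using assms(1,2) by (auto simp: t idx_def)
  have fin: "finite I" "finite I'"
    using I finite_subset by blast+
  let ?S = "mset_set (I - {n}) + M" and ?S' = "mset_set (I' - {n}) + M'"
  obtain g where g: "g permutes {1..n}" "m = perm_exp g (e_exp n I)" "u = perm_exp g (lam ?S)"
    using assms(3) by (auto simp: t lead_def e_exp_def lam_union)
  obtain h where h: "h permutes {1..n}" "m' = perm_exp h (e_exp n I')" "u = perm_exp h (lam ?S')"
    using assms(4) by (auto simp: t lead_def e_exp_def lam_union)
  define h' where "h' = inv_into UNIV h"
  have h': "bij h'" "h' \<circ> h = id" "h \<circ> h' = id"
    using permutes_bij[OF h(1)] by (auto simp: h'_def bij_imp_bij_inv bij_is_inj surj_iff[symmetric] bij_is_surj)
  define k where "k = h' \<circ> g"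
  have k: "bij k"
    using h' g(1) by (simp add: k_def bij_comp permutes_bij)
  have perm: "perm_exp k = (\<lambda>v. perm_exp h' (perm_exp g v))"
    using h' g(1) by (simp add: k_def perm_exp_comp permutes_bij fun_eq_iff)
  have "perm_exp h' (perm_exp h (lam ?S')) = lam ?S'"
    by (metis perm_exp_comp[OF h'(1) permutes_bij[OF h(1)]] h'(2) perm_exp_id)
  then have eq: "perm_exp k (lam ?S) = lam ?S'"
    by (simp add: perm g(3)[symmetric] h(3)[symmetric])
  then have "lam ?S = lam ?S'"
    by (rule perm_exp_lam_eq[OF k])
  then have S: "?S = ?S'"
    using I fin by (intro lam_inj) auto
  have "I = insert n (set_mset ?S)" "I' = insert n (set_mset ?S')"
    using I fin by auto
  then have II: "I = I'"
    using S by simp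
  then have MM: "M = M'"
    using S by simp
  \<comment> \<open>So far \<open>k\<close> is only known to fix the sum of \<open>e_exp n I\<close>
    and \<open>lam M\<close>. Both summands decrease on \<open>{1..n}\<close>, so if their sum
    agrees at \<open>j\<close> and \<open>k j\<close>, each of them does.\<close>
  have "perm_exp k (e_exp n I) = e_exp n I"
  proof (rule perm_exp_eqI[OF k])
    fix j
    have 0: "i \<notin> {1..n} \<Longrightarrow> k i = i" for i
      using permutes_not_in[OF g(1)] permutes_not_in[OF permutes_inv[OF h(1)]] by (simp add: k_def h'_def)
    have 1: "k j \<in> {1..n}" if "j \<in> {1..n}"
      using that g(1) h(1) by (metis comp_apply k_def h'_def permutes_in_image permutes_inv)
    have "Poly_Mapping.lookup (lam ?S) (k j) = Poly_Mapping.lookup (lam ?S) j"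
      using eq S lookup_perm_exp[OF k] by metis
    then have 2: "Poly_Mapping.lookup (e_exp n I) (k j) + Poly_Mapping.lookup (lam M) (k j) =
      Poly_Mapping.lookup (e_exp n I) j + Poly_Mapping.lookup (lam M) j"
      by (simp add: e_exp_def lam_union lookup_add)
    show "Poly_Mapping.lookup (e_exp n I) (k j) = Poly_Mapping.lookup (e_exp n I) j"
    proof (cases "j \<in> {1..n}")
      case True
      have anti: "Poly_Mapping.lookup (lam U) b \<le> Poly_Mapping.lookup (lam U) a" if "1 \<le> a" "a \<le> b" for U a b
        using that by (rule lookup_lam_antimono)
      show ?thesis
        using 1[OF True] 2 True anti[of j "k j" "mset_set (I - {n})"] anti[of "k j" j "mset_set (I - {n})"]
          anti[of j "k j" M] anti[of "k j" j M] unfolding e_exp_def by (cases "j \<le> k j") auto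
    qed (use 0 in simp)
  qed
  then have "perm_exp h' m = e_exp n I"
    by (simp add: perm g(2))
  then have "m = perm_exp h (e_exp n I)"
    using h' h(1) by (metis perm_exp_comp perm_exp_id permutes_bij)
  then show ?thesis
    by (simp add: t II MM h(2))
qed

section \<open>Every exponent vector is a leading exponent\<close>

lemma ex_sorting_perm:
  fixes u :: "nat \<Rightarrow> nat"
  obtains g v where "g permutes {1..n}" "\<And>j. j \<in> {1..n} \<Longrightarrow> v j = u (g j)"
    "\<And>j. 1 \<le> j \<Longrightarrow> j < n \<Longrightarrow> v (Suc j) \<le> v j"
proof -
  define xs where "xs = rev (sort (map u [1..<Suc n]))"
  \<comment> \<open>Positions start at 1, list indices at 0.\<close>
  define v where "v = (\<lambda>j. xs ! (j - 1))"
  have len: "length xs = n"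
    by (simp add: xs_def)
  have map: "map v [1..<Suc n] = xs"
    by (rule nth_equalityI) (auto simp: len v_def simp del: upt_Suc)
  have ms: "mset_set {1..n} = mset [1..<Suc n]"
    by (metis atLeastLessThanSuc_atLeastAtMost mset_upt)
  have "image_mset v (mset_set {1..n}) = mset (map v [1..<Suc n])"
    by (simp only: ms mset_map)
  also have "\<dots> = image_mset u (mset_set {1..n})"
    unfolding map by (simp only: xs_def ms mset_rev mset_sort mset_map)
  \<comment> \<open>Two functions with the same multiset of values on a finite set differ by a
    permutation of that set.\<close>
  finally obtain g where g: "g permutes {1..n}" "\<forall>j\<in>{1..n}. v j = u (g j)"
    using image_mset_eq_implies_permutes[of "{1..n}" v u] by blast
  have "sorted (rev xs)"
    by (simp add: xs_def)
  then have "v (Suc j) \<le> v j" if "1 \<le> j" "j < n" for j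
    using that len sorted_rev_nth_mono[of xs "j - 1" j] by (simp add: v_def)
  with g show ?thesis
    using that by blast
qed

lemma ex_lam:
  assumes "\<And>j. 1 \<le> j \<Longrightarrow> j < n \<Longrightarrow> v (Suc j) \<le> (v j :: nat)"
  obtains S where "set_mset S \<subseteq> {1..n}" "\<And>j. j \<in> {1..n} \<Longrightarrow> Poly_Mapping.lookup (lam S) j = v j"
proof -
  \<comment> \<open>The drops of \<open>v\<close>, with \<open>v\<close> read as 0 beyond position
    \<open>n\<close>: by \<open>lookup_lam_Suc\<close> these multiplicities are forced.\<close>
  define c where "c = (\<lambda>i. if i = n then v n else v i - v (Suc i))"
  define S where "S = (\<Sum>i\<in>{1..n}. replicate_mset (c i) i)"
  have S: "set_mset S \<subseteq> {1..n}"
    by (auto simp: S_def set_mset_sum split: if_splits)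
  have cnt: "count S j = c j" if "j \<in> {1..n}" for j
    using that by (simp add: S_def count_sum)
  have "Poly_Mapping.lookup (lam S) j = v j" if "1 \<le> j" "j \<le> n" for j
    using that(2,1)
  proof (induction j rule: inc_induct)
    case base
    have "Poly_Mapping.lookup (lam S) (Suc n) = 0"
      using keys_lam[OF S] by (auto simp: in_keys_iff)
    then show ?case
      using base lookup_lam_Suc[of n S] cnt[of n] by (simp add: c_def)
  next
    case (step j)
    then show ?case
      using lookup_lam_Suc[of j S] cnt[of j] assms[of j] by (simp add: c_def)
  qed
  then show ?thesis
    using that S by auto
qed

lemma ex_idx_lead:
  assumes "n \<ge> 1" "Poly_Mapping.keys u \<subseteq> {1..n}"
  shows "\<exists>t\<in>idx n. lead n t u"
proof -
  obtain g v where g: "g permutes {1..n}" "\<And>j. j \<in> {1..n} \<Longrightarrow> v j = Poly_Mapping.lookup u (g j)"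
    "\<And>j. 1 \<le> j \<Longrightarrow> j < n \<Longrightarrow> v (Suc j) \<le> v j"
    using ex_sorting_perm[of n "Poly_Mapping.lookup u"] by metis
  obtain S where S: "set_mset S \<subseteq> {1..n}" "\<And>j. j \<in> {1..n} \<Longrightarrow> Poly_Mapping.lookup (lam S) j = v j"
    using ex_lam[of n v] g(3) by blast
  have u: "perm_exp g (lam S) = u"
  proof (rule perm_exp_eqI[OF permutes_bij[OF g(1)]])
    fix j
    show "Poly_Mapping.lookup u (g j) = Poly_Mapping.lookup (lam S) j"
    proof (cases "j \<in> {1..n}")
      case False
      then have "g j \<notin> Poly_Mapping.keys u" "j \<notin> Poly_Mapping.keys (lam S)"
        using assms(2) keys_lam[OF S(1)] permutes_in_image[OF g(1)] by blast+
      then show ?thesis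
        by (simp add: in_keys_iff)
    qed (use S g in simp)
  qed
  \<comment> \<open>One copy of each element of \<open>S\<close> other than \<open>n\<close> goes
    into the packed monomial. The surplus copies, and all copies of \<open>n\<close>, form
    \<open>M\<close>.\<close>
  define I where "I = insert n (set_mset S)"
  define M where "M = S - mset_set (I - {n})"
  have "mset_set (I - {n}) \<subseteq># S"
    by (rule mset_subset_eqI) (auto simp: I_def count_mset_set' Suc_le_eq)
  then have SM: "S = mset_set (I - {n}) + M"
    by (simp add: M_def)
  have "set_mset M \<subseteq> I"
    unfolding M_def I_def by (meson in_diffD subsetI insertI2)
  then have "(I, M, perm_exp g (e_exp n I)) \<in> idx n"
    using assms(1) S(1) g(1) by (auto simp: idx_def I_def orbit_def)
  moreover have "lead n (I, M, perm_exp g (e_exp n I)) u"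
    using g(1) u[symmetric] by (auto simp: lead_def e_exp_def lam_union[symmetric] SM[symmetric])
  ultimately show ?thesis
    by blast
qed

section \<open>A basis of the polynomial ring\<close>

text \<open>Take a term with nonzero coefficient whose leading exponent has the largest sum of
  squares. Another such term could contain this exponent only as its own leading exponent, which
  \<open>lead_inj\<close> forbids; so the coefficient can be read off there.\<close>

lemma bas_independent:
  fixes c :: "nat set \<times> nat multiset \<times> (nat \<Rightarrow>\<^sub>0 nat) \<Rightarrow> 'k::ring_1"
  assumes "finite T" "T \<subseteq> idx n" "(\<Sum>t\<in>T. cst (c t) * bas n (snd t)) = 0" "t \<in> T"
  shows "c t = 0"
proof (rule ccontr)
  assume "c t \<noteq> 0"
  define l where "l = (\<lambda>t. SOME u. lead n t u)"
  have l: "lead n t (l t)" if "t \<in> idx n" for t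
    using ex_lead[OF that] unfolding l_def by (rule someI_ex)
  define T' where "T' = {t \<in> T. c t \<noteq> 0}"
  have T': "finite T'" "T' \<noteq> {}" "T' \<subseteq> idx n"
    using assms(1,2,4) \<open>c t \<noteq> 0\<close> unfolding T'_def by (simp, blast, blast)
  have "Max ((\<lambda>t. sumsq n (l t)) ` T') \<in> (\<lambda>t. sumsq n (l t)) ` T'"
    using T' by (intro Max_in) auto
  then obtain s where s: "s \<in> T'" "sumsq n (l s) = Max ((\<lambda>t. sumsq n (l t)) ` T')"
    by auto
  then have s_max: "sumsq n (l t) \<le> sumsq n (l s)" if "t \<in> T'" for t
    using T'(1) that by auto
  let ?b = "\<lambda>t. bas n (snd t) :: 'k mpol"
  have "Poly_Mapping.lookup (?b t) (l s) = 0" if t: "t \<in> T'" "t \<noteq> s" for t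
  proof (rule ccontr)
    assume "Poly_Mapping.lookup (?b t) (l s) \<noteq> 0"
    then have "l s = l t \<or> sumsq n (l s) < sumsq n (l t)"
      using lead_bas(2)[of t n "l t" "l s", where 'k = 'k] l t T' by (auto simp: in_keys_iff)
    then have "l s = l t"
      using s_max[OF t(1)] by linarith
    then show False
      using lead_inj[of s n t "l s"] l[of s] l[of t] s(1) t T' by auto
  qed
  then have "Poly_Mapping.lookup (\<Sum>t\<in>T'. cst (c t) * ?b t) (l s) = (\<Sum>t\<in>T'. if t = s then c s * Poly_Mapping.lookup (?b s) (l s) else 0)"
    unfolding lookup_sum by (intro sum.cong) (auto simp: lookup_cst_mult)
  also have "\<dots> = c s"
    using s(1) T' lead_bas(1)[of s n "l s", where 'k = 'k] l[of s] by auto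
  also have "(\<Sum>t\<in>T'. cst (c t) * ?b t) = (\<Sum>t\<in>T. cst (c t) * ?b t)"
    using assms(1) by (intro sum.mono_neutral_left) (auto simp: T'_def)
  finally show False
    using s(1) assms(3) by (simp add: T'_def)
qed

lemma bas_poly_ring:
  assumes "t \<in> idx n"
  shows "(bas n (snd t) :: 'k::ring_1 mpol) \<in> poly_ring n"
proof -
  obtain I M m where t: "t = (I, M, m)"
    by (cases t) auto
  then obtain g where g: "g permutes {1..n}" "m = perm_exp g (e_exp n I)" "I \<subseteq> {1..n}"
    using assms by (auto simp: idx_def orbit_def)
  then have "Poly_Mapping.keys (e_exp n I) \<subseteq> {1..n}"
    unfolding e_exp_def by (intro keys_lam) (auto simp: finite_subset)
  then have "Poly_Mapping.keys m \<subseteq> {1..n}"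
    using g keys_perm_exp[OF permutes_bij[OF g(1)]] permutes_image[OF g(1)] by blast
  then show ?thesis
    by (simp add: t bas_def poly_ring_mult poly_ring_dprod poly_ring_xmonom)
qed

text \<open>The basis element led by \<open>u\<close> has coefficient 1 there, so
  \<open>xmonom u\<close> can be solved for without division in \<open>k\<close>; the other terms
  have smaller sums of squares. The scalar \<open>c\<close> belongs to the claim because
  \<open>add_span\<close> only provides sums.\<close>

lemma xmonom_bas_span:
  assumes "n \<ge> 1" "Poly_Mapping.keys u \<subseteq> {1..n}"
  shows "cst c * (xmonom u :: 'k::ring_1 mpol) \<in> add_span {cst c * bas n (snd t) |c t. t \<in> idx n}" (is "_ \<in> add_span ?X")
  using assms(2)
proof (induction "sumsq n u" arbitrary: u c rule: less_induct)
  case less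
  obtain t where t: "t \<in> idx n" "lead n t u"
    using ex_idx_lead[OF assms(1) less.prems] by blast
  let ?b = "bas n (snd t) :: 'k mpol"
  let ?K = "Poly_Mapping.keys ?b"
  have u: "Poly_Mapping.lookup ?b u = 1" "u \<in> ?K"
    using lead_bas(1)[OF t, where 'k = 'k] by (auto simp: in_keys_iff)
  let ?r = "\<Sum>w\<in>?K - {u}. cst (Poly_Mapping.lookup ?b w) * xmonom w"
  have "?b = (\<Sum>w\<in>?K. cst (Poly_Mapping.lookup ?b w) * xmonom w)"
    by (rule poly_mapping_xmonom_expand)
  also have "\<dots> = xmonom u + ?r"
    by (simp add: sum.remove[OF finite_keys u(2)] u(1))
  finally have "cst c * ?b = cst c * (xmonom u + ?r)"
    by (rule arg_cong)
  then have "cst c * ?b = cst c * xmonom u + cst c * ?r"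
    by (simp only: distrib_left)
  then have "cst c * xmonom u = cst c * ?b + cst (- c) * ?r"
    by (simp add: cst_def single_uminus)
  also have "cst (- c) * ?r = (\<Sum>w\<in>?K - {u}. cst (- c * Poly_Mapping.lookup ?b w) * xmonom w)"
    by (simp only: sum_distrib_left cst_mult mult.assoc)
  also have "cst c * ?b + \<dots> \<in> add_span ?X"
  proof (intro add_span.add add_span_sum)
    show "cst c * ?b \<in> add_span ?X"
      using t by (intro add_span.base) blast
    fix w assume w: "w \<in> ?K - {u}"
    show "cst (- c * Poly_Mapping.lookup ?b w) * xmonom w \<in> add_span ?X"
    proof (rule less.hyps)
      show "sumsq n w < sumsq n u"
        using lead_bas(2)[OF t, where 'k = 'k] w by blast
      show "Poly_Mapping.keys w \<subseteq> {1..n}"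
        using bas_poly_ring[OF t(1), where 'k = 'k] w unfolding poly_ring_def by blast
    qed
  qed
  finally show ?case .
qed

lemma poly_ring_bas_span:
  assumes "n \<ge> 1" "p \<in> poly_ring n"
  shows "p \<in> add_span {cst c * bas n (snd t) |c t. t \<in> idx n}" (is "_ \<in> add_span ?X")
proof -
  have "(\<Sum>m\<in>Poly_Mapping.keys p. cst (Poly_Mapping.lookup p m) * xmonom m) \<in> add_span ?X"
    by (intro add_span_sum xmonom_bas_span assms(1)) (use assms(2) in \<open>auto simp: poly_ring_def\<close>)
  then show ?thesis
    using poly_mapping_xmonom_expand[of p] by simp
qed

section \<open>Tensor products\<close>

lemma comm_group_cong:
  assumes "comm_group G" "carrier H = carrier G" "monoid.mult H = monoid.mult G" "one H = one G"
  shows "comm_group H"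
proof -
  interpret G: comm_group G by fact
  show ?thesis
    by (rule comm_groupI) (use assms G.m_assoc G.m_comm G.l_inv_ex in auto)
qed

section \<open>Induced maps and evaluation on free abelian groups\<close>

definition frag_map :: "('a \<Rightarrow> 'b) \<Rightarrow> ('a \<Rightarrow>\<^sub>0 int) \<Rightarrow> ('b \<Rightarrow>\<^sub>0 int)"
  where "frag_map f = frag_extend (\<lambda>z. frag_of (f z))"

lemma frag_map_of [simp]: "frag_map f (frag_of z) = frag_of (f z)"
  by (simp add: frag_map_def)

lemma frag_map_zero [simp]: "frag_map f 0 = 0"
  by (simp add: frag_map_def)

lemma frag_map_add: "frag_map f (x + y) = frag_map f x + frag_map f y"
  by (simp add: frag_map_def frag_extend_add)

lemma frag_map_diff: "frag_map f (x - y) = frag_map f x - frag_map f y"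
  by (simp add: frag_map_def frag_extend_diff)

lemma frag_induct [case_names zero of diff]:
  assumes "P 0" "\<And>z. P (frag_of z)" "\<And>x y. P x \<Longrightarrow> P y \<Longrightarrow> P (x - y)"
  shows "P t"
  using frag_induction[of t UNIV P] assms by auto

lemma frag_map_id: "frag_map id t = t"
  by (induction t rule: frag_induct) (auto simp: frag_map_diff)

lemma frag_map_comp: "frag_map f (frag_map g t) = frag_map (\<lambda>z. f (g z)) t"
  by (induction t rule: frag_induct) (auto simp: frag_map_diff)

lemma keys_frag_map: "Poly_Mapping.keys t \<subseteq> S \<Longrightarrow> f ` S \<subseteq> T \<Longrightarrow> Poly_Mapping.keys (frag_map f t) \<subseteq> T"
  using keys_frag_extend[of "\<lambda>z. frag_of (f z)" t] unfolding frag_map_def by (fastforce simp: keys_frag_of)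

text \<open>The sum inside \<open>tensor_mult\<close>, that is, the additive extension of
  \<open>(a, b) \<mapsto> a * b\<close>.\<close>

definition frag_ev :: "('k::ring_1 mpol \<times> 'k mpol \<Rightarrow>\<^sub>0 int) \<Rightarrow> 'k mpol"
  where "frag_ev t = (\<Sum>z\<in>Poly_Mapping.keys t. of_int (Poly_Mapping.lookup t z) * (fst z * snd z))"

lemma frag_ev_add: "frag_ev (s + t) = frag_ev s + frag_ev t"
proof -
  \<comment> \<open>Terms may cancel in \<open>s + t\<close>, so all three sums are taken over one
    common index set.\<close>
  define Z where "Z = Poly_Mapping.keys s \<union> Poly_Mapping.keys t \<union> Poly_Mapping.keys (s + t)"
  have "frag_ev u = (\<Sum>z\<in>Z. of_int (Poly_Mapping.lookup u z) * (fst z * snd z))"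
    if "Poly_Mapping.keys u \<subseteq> Z" for u
    unfolding frag_ev_def
    by (rule sum_keys_superset[where f = "\<lambda>z c. of_int c * (fst z * snd z)"]) (use that in \<open>auto simp: Z_def\<close>)
  moreover have "Poly_Mapping.keys s \<subseteq> Z" "Poly_Mapping.keys t \<subseteq> Z" "Poly_Mapping.keys (s + t) \<subseteq> Z"
    by (auto simp: Z_def)
  ultimately show ?thesis
    by (simp add: lookup_add distrib_right sum.distrib)
qed

lemma frag_ev_zero [simp]: "frag_ev 0 = 0"
  by (simp add: frag_ev_def)

lemma frag_ev_uminus: "frag_ev (- s) = - frag_ev s"
  using frag_ev_add[of s "- s"] by (simp add: eq_neg_iff_add_eq_0 add.commute)

lemma frag_ev_diff: "frag_ev (s - t) = frag_ev s - frag_ev t"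
  using frag_ev_add[of s "- t"] by (simp add: frag_ev_uminus)

lemma frag_ev_of [simp]: "frag_ev (frag_of z) = fst z * snd z"
  by (simp add: frag_ev_def keys_frag_of)

lemma frag_ev_sum: "frag_ev (sum f S) = (\<Sum>i\<in>S. frag_ev (f i))"
  by (induction S rule: infinite_finite_induct) (auto simp: frag_ev_add)

lemma frag_ev_smul: "frag_ev (frag_map (\<lambda>(a, b). (cst c * a, b)) t) = cst c * frag_ev t"
  by (induction t rule: frag_induct)
    (auto simp: frag_map_diff frag_ev_diff right_diff_distrib mult.assoc split: prod.splits)

text \<open>\<open>A\<close> has to be a bimodule: its right scalars enter the balancing relation,
  its left scalars act on the tensor product. The group acts through \<open>B\<close> alone.\<close>

locale tensor_factors =
  fixes n :: nat and A B :: "'k::ring_1 mpol set"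
  assumes zeroA: "0 \<in> A"
    and addA: "\<And>a a'. a \<in> A \<Longrightarrow> a' \<in> A \<Longrightarrow> a + a' \<in> A"
    and leftA: "\<And>c a. a \<in> A \<Longrightarrow> cst c * a \<in> A"
    and rightA: "\<And>c a. a \<in> A \<Longrightarrow> a * cst c \<in> A"
    and subB: "kG_submodule n B"
begin

lemma zeroB: "0 \<in> B"
  and addB: "b \<in> B \<Longrightarrow> b' \<in> B \<Longrightarrow> b + b' \<in> B"
  and leftB: "b \<in> B \<Longrightarrow> cst c * b \<in> B"
  and permB: "g permutes {1..n} \<Longrightarrow> b \<in> B \<Longrightarrow> perm_act g b \<in> B"
  using subB by (auto simp: kG_submodule_def)

abbreviation "F \<equiv> free_Abelian_group (A \<times> B)"
abbreviation "K \<equiv> tensor_kernel A B"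
abbreviation "R \<equiv> tensor_relators A B"

text \<open>The tensor represented by \<open>t\<close>. It makes sense for every \<open>t\<close>,
  even outside the support \<open>A \<times> B\<close>, so that \<open>mult_T\<close> and
  \<open>smul_T\<close> carry no side condition on \<open>t\<close>.\<close>

definition cls :: "('k mpol \<times> 'k mpol \<Rightarrow>\<^sub>0 int) \<Rightarrow> ('k mpol \<times> 'k mpol \<Rightarrow>\<^sub>0 int) set"
  where "cls t = (\<lambda>h. h + t) ` K"

lemma relator_addl: "a \<in> A \<Longrightarrow> a' \<in> A \<Longrightarrow> b \<in> B \<Longrightarrow> frag_of (a + a', b) - frag_of (a, b) - frag_of (a', b) \<in> R"
  and relator_addr: "a \<in> A \<Longrightarrow> b \<in> B \<Longrightarrow> b' \<in> B \<Longrightarrow> frag_of (a, b + b') - frag_of (a, b) - frag_of (a, b') \<in> R"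
  and relator_bal: "a \<in> A \<Longrightarrow> b \<in> B \<Longrightarrow> frag_of (a * cst c, b) - frag_of (a, cst c * b) \<in> R"
  unfolding tensor_relators_def by blast+

lemma relator_cases [consumes 1, case_names addl addr bal]:
  assumes "r \<in> R"
    "\<And>a a' b. \<lbrakk>a \<in> A; a' \<in> A; b \<in> B; r = frag_of (a + a', b) - frag_of (a, b) - frag_of (a', b)\<rbrakk> \<Longrightarrow> P"
    "\<And>a b b'. \<lbrakk>a \<in> A; b \<in> B; b' \<in> B; r = frag_of (a, b + b') - frag_of (a, b) - frag_of (a, b')\<rbrakk> \<Longrightarrow> P"
    "\<And>a b c. \<lbrakk>a \<in> A; b \<in> B; r = frag_of (a * cst c, b) - frag_of (a, cst c * b)\<rbrakk> \<Longrightarrow> P"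
  shows P
  using assms unfolding tensor_relators_def by blast

lemma keys_relator: "r \<in> R \<Longrightarrow> Poly_Mapping.keys r \<subseteq> A \<times> B"
proof (induction rule: relator_cases)
  case (addl a a' b)
  show ?case
    unfolding addl(4) using addl(1-3) addA
    by (intro order_trans[OF keys_diff] Un_least) (auto simp: keys_frag_of)
next
  case (addr a b b')
  show ?case
    unfolding addr(4) using addr(1-3) addB
    by (intro order_trans[OF keys_diff] Un_least) (auto simp: keys_frag_of)
next
  case (bal a b c)
  show ?case
    unfolding bal(3) using bal(1-2) leftB rightA
    by (intro order_trans[OF keys_diff] Un_least) (auto simp: keys_frag_of)
qed

lemma subgroup_K: "subgroup K F"
  unfolding tensor_kernel_def
  by (rule group.generate_is_subgroup) (use keys_relator in auto)

lemma keys_K: "x \<in> K \<Longrightarrow> Poly_Mapping.keys x \<subseteq> A \<times> B"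
  using subgroup.mem_carrier[OF subgroup_K] by (simp only: carrier_free_Abelian_group_iff)

lemma zero_K: "0 \<in> K"
  using subgroup.one_closed[OF subgroup_K] by simp

lemma add_K: "x \<in> K \<Longrightarrow> y \<in> K \<Longrightarrow> x + y \<in> K"
  using subgroup.m_closed[OF subgroup_K] by simp

lemma uminus_K: "x \<in> K \<Longrightarrow> - x \<in> K"
  using subgroup.m_inv_closed[OF subgroup_K, of x] keys_K by simp

lemma diff_K: "x \<in> K \<Longrightarrow> y \<in> K \<Longrightarrow> x - y \<in> K"
  using add_K[of x "- y"] uminus_K by simp

lemma sum_K: "(\<And>i. i \<in> S \<Longrightarrow> f i \<in> K) \<Longrightarrow> sum f S \<in> K"
  by (induction S rule: infinite_finite_induct) (auto intro: zero_K add_K)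

lemma relator_K: "r \<in> R \<Longrightarrow> r \<in> K"
  by (simp add: tensor_kernel_def generate.incl)

text \<open>Closure under differences covers products and inverses at once. The group inverse is
  negation on the carrier, hence the appeal to \<open>keys_relator\<close>.\<close>

lemma K_induct [consumes 1, case_names zero relator diff]:
  assumes "x \<in> K" "P 0" "\<And>r. r \<in> R \<Longrightarrow> P r" "\<And>x y. P x \<Longrightarrow> P y \<Longrightarrow> P (x - y)"
  shows "P x"
  using assms(1) unfolding tensor_kernel_def
proof induction
  case (inv h)
  then show ?case
    using assms(4)[of 0 h] assms(2,3) keys_relator by simp
next
  case (eng x y)
  then show ?case
    using assms(4)[of x "0 - y"] assms(4)[of 0 y] assms(2) by simp
qed (use assms in auto)

lemma cls_eq_iff: "cls t = cls t' \<longleftrightarrow> t - t' \<in> K"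
proof
  assume "cls t = cls t'"
  then have "t \<in> cls t'"
    using zero_K unfolding cls_def by force
  then show "t - t' \<in> K"
    by (auto simp: cls_def)
next
  have sub: "cls t \<subseteq> cls t'" if "t - t' \<in> K" for t t'
  proof
    fix x assume "x \<in> cls t"
    then obtain h where "h \<in> K" "x = h + t"
      by (auto simp: cls_def)
    then have "x = (h + (t - t')) + t'" "h + (t - t') \<in> K"
      using that add_K by auto
    then show "x \<in> cls t'"
      unfolding cls_def by blast
  qed
  assume "t - t' \<in> K"
  then show "cls t = cls t'"
    using sub[of t t'] sub[of t' t] uminus_K[of "t - t'"] by auto
qed

abbreviation "T \<equiv> tensor_module A B"

lemma carrier_T: "carrier T = cls ` {t. Poly_Mapping.keys t \<subseteq> A \<times> B}"
proof -
  have "K #>\<^bsub>F\<^esub> t = cls t" for t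
    by (auto simp: r_coset_def cls_def)
  then show ?thesis
    by (auto simp: tensor_module_def monoid.defs carrier_FactGroup)
qed

lemma one_T: "one T = cls 0"
  by (simp add: tensor_module_def monoid.defs cls_def)

lemma mult_T: "cls t \<otimes>\<^bsub>T\<^esub> cls t' = cls (t + t')"
proof -
  have "cls t \<otimes>\<^bsub>T\<^esub> cls t' = {x + y |x y. x \<in> cls t \<and> y \<in> cls t'}"
    by (auto simp: tensor_module_def monoid.defs set_mult_def)
  also have "\<dots> = cls (t + t')"
  proof (intro equalityI subsetI)
    fix z assume "z \<in> {x + y |x y. x \<in> cls t \<and> y \<in> cls t'}"
    then obtain h h' where "h \<in> K" "h' \<in> K" "z = (h + t) + (h' + t')"
      by (auto simp: cls_def)
    then have "z = (h + h') + (t + t')" "h + h' \<in> K"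
      by (auto simp: add_K)
    then show "z \<in> cls (t + t')"
      unfolding cls_def by blast
  next
    fix z assume "z \<in> cls (t + t')"
    then obtain h where "h \<in> K" "z = (h + t) + (0 + t')"
      by (auto simp: cls_def add.assoc)
    then show "z \<in> {x + y |x y. x \<in> cls t \<and> y \<in> cls t'}"
      using zero_K unfolding cls_def by blast
  qed
  finally show ?thesis .
qed

lemma comm_group_T: "comm_group T"
proof (rule comm_groupI)
  fix x y assume "x \<in> carrier T" "y \<in> carrier T"
  then obtain s t where *: "x = cls s" "y = cls t" "Poly_Mapping.keys s \<subseteq> A \<times> B" "Poly_Mapping.keys t \<subseteq> A \<times> B"
    by (auto simp: carrier_T)
  then have "Poly_Mapping.keys (s + t) \<subseteq> A \<times> B"
    using keys_add[of s t] by blast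
  then show "x \<otimes>\<^bsub>T\<^esub> y \<in> carrier T"
    using * by (auto simp: mult_T carrier_T)
  show "x \<otimes>\<^bsub>T\<^esub> y = y \<otimes>\<^bsub>T\<^esub> x"
    using * by (simp add: mult_T add.commute)
next
  fix x assume "x \<in> carrier T"
  then obtain s where *: "x = cls s" "Poly_Mapping.keys s \<subseteq> A \<times> B"
    by (auto simp: carrier_T)
  then show "\<exists>y\<in>carrier T. y \<otimes>\<^bsub>T\<^esub> x = \<one>\<^bsub>T\<^esub>"
    by (intro bexI[of _ "cls (- s)"]) (auto simp: mult_T one_T carrier_T)
  show "\<one>\<^bsub>T\<^esub> \<otimes>\<^bsub>T\<^esub> x = x"
    using * by (simp add: mult_T one_T)
qed (auto simp: carrier_T one_T mult_T add.assoc)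

section \<open>Scalars and group action on the tensor product\<close>

lemma frag_map_K:
  assumes "\<And>r. r \<in> R \<Longrightarrow> frag_map f r \<in> K" "x \<in> K"
  shows "frag_map f x \<in> K"
  using assms(2) by (induction rule: K_induct) (auto simp: zero_K assms frag_map_diff diff_K)

text \<open>A map sending each relator into the kernel preserves the whole kernel, so the
  representative of the coset does not matter.\<close>

lemma tensor_map_cls:
  assumes "\<And>r. r \<in> R \<Longrightarrow> frag_map f r \<in> K"
  shows "tensor_map A B f (cls t) = cls (frag_map f t)"
proof -
  have "tensor_map A B f (cls t) = {h + frag_map f (h' + t) |h h'. h \<in> K \<and> h' \<in> K}"
    by (auto simp: tensor_map_def set_mult_def cls_def frag_map_def)
  also have "\<dots> = cls (frag_map f t)"
  proof (intro equalityI subsetI)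
    fix z assume "z \<in> {h + frag_map f (h' + t) |h h'. h \<in> K \<and> h' \<in> K}"
    then obtain h h' where "h \<in> K" "h' \<in> K" "z = h + frag_map f (h' + t)"
      by auto
    then have "z = (h + frag_map f h') + frag_map f t" "h + frag_map f h' \<in> K"
      by (auto simp: add_K frag_map_K[OF assms] frag_map_add add.assoc)
    then show "z \<in> cls (frag_map f t)"
      unfolding cls_def by blast
  next
    fix z assume "z \<in> cls (frag_map f t)"
    then obtain h where "h \<in> K" "z = h + frag_map f (0 + t)"
      by (auto simp: cls_def)
    then show "z \<in> {h + frag_map f (h' + t) |h h'. h \<in> K \<and> h' \<in> K}"
      using zero_K by blast
  qed
  finally show ?thesis .
qed

lemma smul_T: "smul T c (cls t) = cls (frag_map (\<lambda>(a, b). (cst c * a, b)) t)"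
proof -
  have "frag_map (\<lambda>(a, b). (cst c * a, b)) r \<in> K" if "r \<in> R" for r
    using that
  proof (induction rule: relator_cases)
    case (addl a a' b)
    then show ?case
      using relator_addl[of "cst c * a" "cst c * a'" b]
      by (simp add: frag_map_diff distrib_left leftA relator_K)
  next
    case (addr a b b')
    then show ?case
      using relator_addr[of "cst c * a" b b'] by (simp add: frag_map_diff leftA relator_K)
  next
    case (bal a b d)
    then show ?case
      using relator_bal[of "cst c * a" b d] by (simp add: frag_map_diff leftA relator_K mult.assoc)
  qed
  then show ?thesis
    by (simp add: tensor_module_def monoid.defs kG_mod.defs tensor_map_cls)
qed

text \<open>The balancing relators are respected because a permutation of the variables fixes the
  constants.\<close>

lemma gact_T:
  assumes "g permutes {1..n}"
  shows "gact T g (cls t) = cls (frag_map (\<lambda>(a, b). (a, perm_act g b)) t)"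
proof -
  note g = permutes_bij[OF assms]
  have "frag_map (\<lambda>(a, b). (a, perm_act g b)) r \<in> K" if "r \<in> R" for r
    using that
  proof (induction rule: relator_cases)
    case (addl a a' b)
    then show ?case
      using relator_addl[of a a' "perm_act g b"] by (simp add: frag_map_diff permB[OF assms] relator_K)
  next
    case (addr a b b')
    then show ?case
      using relator_addr[of a "perm_act g b" "perm_act g b'"]
      by (simp add: frag_map_diff permB[OF assms] relator_K perm_act_add[OF g])
  next
    case (bal a b d)
    then show ?case
      using relator_bal[of a "perm_act g b" d]
      by (simp add: frag_map_diff permB[OF assms] relator_K perm_act_mult[OF g] perm_act_cst)
  qed
  then show ?thesis
    by (simp add: tensor_module_def monoid.defs kG_mod.defs tensor_map_cls)
qed

text \<open>On the free abelian group itself the scalars do not act additively in the scalar; this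
  holds only modulo the relators for sums in the left factor.\<close>

lemma smul_add_K:
  assumes "Poly_Mapping.keys t \<subseteq> A \<times> B"
  shows "frag_map (\<lambda>(a, v). (cst (b + c) * a, v)) t -
    (frag_map (\<lambda>(a, v). (cst b * a, v)) t + frag_map (\<lambda>(a, v). (cst c * a, v)) t) \<in> K" (is "?f t \<in> K")
  using assms
proof (induction rule: frag_induction)
  case (one z)
  then obtain a v where "z = (a, v)" "a \<in> A" "v \<in> B"
    by auto
  then show ?case
    using relator_K[OF relator_addl[of "cst b * a" "cst c * a" v]]
    by (simp add: leftA cst_add distrib_right diff_diff_eq)
next
  case (diff x y)
  have "?f (x - y) = ?f x - ?f y"
    by (simp add: frag_map_diff)
  then show ?case
    using diff_K[OF diff(1,2)] by (simp only:)
qed (simp add: zero_K)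

lemma kG_module_T: "kG_module n T"
  unfolding kG_module_def
proof (intro conjI allI ballI impI)
  show "comm_group T"
    by (rule comm_group_T)
next
  fix c x assume "x \<in> carrier T"
  then obtain t where t: "x = cls t" "Poly_Mapping.keys t \<subseteq> A \<times> B"
    by (auto simp: carrier_T)
  show "smul T c x \<in> carrier T"
    unfolding t(1) smul_T carrier_T
    using leftA by (intro imageI CollectI keys_frag_map[OF t(2)]) auto
next
  fix c x y assume "x \<in> carrier T" "y \<in> carrier T"
  then show "smul T c (x \<otimes>\<^bsub>T\<^esub> y) = smul T c x \<otimes>\<^bsub>T\<^esub> smul T c y"
    by (auto simp: carrier_T mult_T smul_T frag_map_add)
next
  fix b c x assume "x \<in> carrier T"
  then obtain t where t: "x = cls t" "Poly_Mapping.keys t \<subseteq> A \<times> B"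
    by (auto simp: carrier_T)
  show "smul T (b + c) x = smul T b x \<otimes>\<^bsub>T\<^esub> smul T c x"
    unfolding t(1) mult_T smul_T cls_eq_iff by (rule smul_add_K[OF t(2)])
next
  fix b c x assume "x \<in> carrier T"
  then show "smul T (b * c) x = smul T b (smul T c x)"
    by (auto simp: carrier_T smul_T frag_map_comp cst_mult mult.assoc case_prod_unfold)
next
  fix x assume "x \<in> carrier T"
  then show "smul T 1 x = x"
    by (auto simp: carrier_T smul_T frag_map_id id_def[symmetric])
next
  fix g x assume g: "g permutes {1..n}" and "x \<in> carrier T"
  then obtain t where t: "x = cls t" "Poly_Mapping.keys t \<subseteq> A \<times> B"
    by (auto simp: carrier_T)
  show "gact T g x \<in> carrier T"
    unfolding t(1) gact_T[OF g] carrier_T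
    using permB[OF g] by (intro imageI CollectI keys_frag_map[OF t(2)]) auto
next
  fix g x y assume "g permutes {1..n}" "x \<in> carrier T" "y \<in> carrier T"
  then show "gact T g (x \<otimes>\<^bsub>T\<^esub> y) = gact T g x \<otimes>\<^bsub>T\<^esub> gact T g y"
    by (auto simp: carrier_T mult_T gact_T frag_map_add)
next
  fix g h x assume "g permutes {1..n}" "h permutes {1..n}" "x \<in> carrier T"
  then show "gact T (g \<circ> h) x = gact T g (gact T h x)"
    by (auto simp: carrier_T gact_T permutes_compose frag_map_comp case_prod_unfold perm_act_comp permutes_bij)
next
  fix x assume "x \<in> carrier T"
  then show "gact T id x = x"
    by (auto simp: carrier_T gact_T permutes_id frag_map_id id_def[symmetric])
next
  fix g c x assume "g permutes {1..n}" "x \<in> carrier T"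
  then show "gact T g (smul T c x) = smul T c (gact T g x)"
    by (auto simp: carrier_T gact_T smul_T frag_map_comp case_prod_unfold)
qed

section \<open>The multiplication map and normal forms of tensors\<close>

lemma frag_ev_K: "x \<in> K \<Longrightarrow> frag_ev x = 0"
proof (induction rule: K_induct)
  case (relator r)
  then show ?case
    by (induction rule: relator_cases) (auto simp: frag_ev_diff distrib_left distrib_right mult.assoc)
qed (auto simp: frag_ev_diff)

text \<open>Elements of the kernel evaluate to 0, so the image of a coset is a singleton and
  \<open>the_elem\<close> is meaningful.\<close>

lemma tensor_mult_cls: "tensor_mult (cls t) = frag_ev t"
proof -
  have "frag_ev ` cls t = {frag_ev t}"
    using zero_K by (auto simp: cls_def image_image frag_ev_add frag_ev_K)
  then show ?thesis
    by (simp add: tensor_mult_def frag_ev_def[abs_def])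
qed

text \<open>The left additivity relator with both entries 0 is
  \<open>- frag_of (0, b)\<close>.\<close>

lemma frag_zero_left_K: "b \<in> B \<Longrightarrow> frag_of (0, b) \<in> K"
  using uminus_K[OF relator_K[OF relator_addl[of 0 0 b]]] zeroA by simp

text \<open>Commutation with the coefficients lets all scalars be collected in the left factor.\<close>

lemma normal_form:
  fixes a :: "'i \<Rightarrow> 'k mpol" and b :: "'j \<Rightarrow> 'k mpol"
  assumes A: "A = add_span {cst c * a i |c i. i \<in> P}" and B: "B = add_span {cst c * b j |c j. j \<in> Q}"
    and comm: "\<And>c i. a i * cst c = cst c * a i"
    and t: "Poly_Mapping.keys t \<subseteq> A \<times> B"
  shows "\<exists>Z c. finite Z \<and> Z \<subseteq> P \<times> Q \<and> t - (\<Sum>z\<in>Z. frag_of (cst (c z) * a (fst z), b (snd z))) \<in> K"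
proof -
  have aA: "cst c * a i \<in> A" if "i \<in> P" for c i
    using that unfolding A by (intro add_span.base) blast
  have bB: "b j \<in> B" if "j \<in> Q" for j
    unfolding B using that by (intro add_span.base CollectI exI[of _ 1]) auto
  define nf where "nf = (\<lambda>Z c. \<Sum>z\<in>Z. frag_of (cst (c z) * a (fst z), b (snd z)) :: 'k mpol \<times> 'k mpol \<Rightarrow>\<^sub>0 int)"
  define N where "N = (\<lambda>t. \<exists>Z c. finite Z \<and> Z \<subseteq> P \<times> Q \<and> t - nf Z c \<in> K)"
  \<comment> \<open>Two normal forms are compared on the union of their index sets: the added
    coefficients are 0, and tensors with left factor 0 vanish.\<close>
  have nf_ext: "nf Z (\<lambda>z. if z \<in> Y then c z else 0) - nf Y c \<in> K" if "finite Z" "Z \<subseteq> P \<times> Q" "Y \<subseteq> Z" for Y Z c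
  proof -
    have "nf Z (\<lambda>z. if z \<in> Y then c z else 0) = nf Y c + (\<Sum>z\<in>Z - Y. frag_of (0, b (snd z)))"
      unfolding nf_def using that by (simp add: sum.subset_diff[OF that(3,1)])
    moreover have "(\<Sum>z\<in>Z - Y. frag_of (0, b (snd z))) \<in> K"
      using that bB by (intro sum_K frag_zero_left_K) auto
    ultimately show ?thesis
      by simp
  qed
  have nf_diff: "nf Z c - nf Z (\<lambda>z. c z - d z) - nf Z d \<in> K" if "Z \<subseteq> P \<times> Q" for Z c d
  proof -
    have "nf Z c - nf Z (\<lambda>z. c z - d z) - nf Z d =
      (\<Sum>z\<in>Z. frag_of (cst (c z - d z) * a (fst z) + cst (d z) * a (fst z), b (snd z))
        - frag_of (cst (c z - d z) * a (fst z), b (snd z)) - frag_of (cst (d z) * a (fst z), b (snd z)))"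
      unfolding nf_def by (simp add: sum_subtractf flip: cst_add distrib_right)
    also have "\<dots> \<in> K"
      using that by (intro sum_K relator_K relator_addl aA bB) auto
    finally show ?thesis .
  qed
  have N_cong: "N t" if "N s" "t - s \<in> K" for s t
  proof -
    obtain Z c where *: "finite Z" "Z \<subseteq> P \<times> Q" "s - nf Z c \<in> K"
      using \<open>N s\<close> unfolding N_def by blast
    have "t - nf Z c \<in> K"
      using add_K[OF that(2) *(3)] by simp
    then show ?thesis
      unfolding N_def using * by blast
  qed
  have N_zero: "N 0"
    unfolding N_def by (intro exI[of _ "{}"]) (simp add: nf_def zero_K)
  have N_diff: "N (s - t)" if st: "N s" "N t" for s t
  proof -
    obtain Y c Z d where *: "finite Y" "Y \<subseteq> P \<times> Q" "s - nf Y c \<in> K" "finite Z" "Z \<subseteq> P \<times> Q" "t - nf Z d \<in> K"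
      using st unfolding N_def by blast
    define c' where "c' = (\<lambda>z. if z \<in> Y then c z else 0)"
    define d' where "d' = (\<lambda>z. if z \<in> Z then d z else 0)"
    have 1: "nf (Y \<union> Z) c' - nf Y c \<in> K" "nf (Y \<union> Z) d' - nf Z d \<in> K"
      unfolding c'_def d'_def using * by (intro nf_ext; blast)+
    have 2: "nf (Y \<union> Z) c' - nf (Y \<union> Z) (\<lambda>z. c' z - d' z) - nf (Y \<union> Z) d' \<in> K"
      using * by (intro nf_diff) blast
    \<comment> \<open>A telescoping identity, arranged so that every bracket lies in the
      kernel.\<close>
    have "s - t - nf (Y \<union> Z) (\<lambda>z. c' z - d' z) = (s - nf Y c) - (t - nf Z d)
      - ((nf (Y \<union> Z) c' - nf Y c) - (nf (Y \<union> Z) d' - nf Z d))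
      + (nf (Y \<union> Z) c' - nf (Y \<union> Z) (\<lambda>z. c' z - d' z) - nf (Y \<union> Z) d')"
      by simp
    also have "\<dots> \<in> K"
      by (intro diff_K add_K * 1 2)
    finally show ?thesis
      unfolding N_def using * by (intro exI[of _ "Y \<union> Z"] exI[of _ "\<lambda>z. c' z - d' z"]) auto
  qed
  have N_add: "N (s + t)" if "N s" "N t" for s t
    using N_diff[OF that(1) N_diff[OF N_zero that(2)]] by simp
  have N_gen: "N (frag_of (x, y))" if "x \<in> A" "y \<in> B" for x y
  proof -
    have "x \<in> add_span {cst c * a i |c i. i \<in> P}"
      using that(1) A by simp
    \<comment> \<open>Membership in \<open>A\<close> is carried along because the relators apply
      only to elements of \<open>A\<close>.\<close>
    then have "x \<in> A \<and> N (frag_of (x, y))"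
    proof induction
      case zero
      then show ?case
        using N_cong[OF N_zero] frag_zero_left_K[OF that(2)] zeroA by simp
    next
      case (add x x')
      then show ?case
        using N_cong[OF N_add, of "frag_of (x, y)" "frag_of (x', y)" "frag_of (x + x', y)"]
          relator_K[OF relator_addl[of x x' y]] that(2) addA by (simp add: diff_diff_eq)
    next
      case (base x)
      then obtain c i where x: "x = cst c * a i" "i \<in> P"
        by blast
      then have xA: "x \<in> A"
        using aA by blast
      have "y \<in> add_span {cst c * b j |c j. j \<in> Q}"
        using that(2) B by simp
      then have "y \<in> B \<and> N (frag_of (x, y))"
      proof induction
        case zero
        have "frag_of (x, 0) \<in> K"
          using uminus_K[OF relator_K[OF relator_addr[of x 0 0]]] xA zeroB by simp
        then show ?case
          using N_cong[OF N_zero] zeroB by simp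
      next
        case (add y y')
        then show ?case
          using N_cong[OF N_add, of "frag_of (x, y)" "frag_of (x, y')" "frag_of (x, y + y')"]
            relator_K[OF relator_addr[of x y y']] xA addB by (simp add: diff_diff_eq)
      next
        case (base y)
        then obtain d j where y: "y = cst d * b j" "j \<in> Q"
          by blast
        \<comment> \<open>The scalar of the right factor crosses the tensor sign by balancing and
          then passes \<open>a i\<close>, which commutes with constants.\<close>
        have "x * cst d = cst (c * d) * a i"
          by (simp add: x(1) mult.assoc comm cst_mult)
        then have "frag_of (cst (c * d) * a i, b j) - frag_of (x, y) \<in> K"
          using relator_K[OF relator_bal[of x "b j" d]] xA bB[OF y(2)] by (simp add: y(1))
        then have "frag_of (x, y) - nf {(i, j)} (\<lambda>_. c * d) \<in> K"
          using uminus_K by (fastforce simp: nf_def)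
        then have "N (frag_of (x, y))"
          unfolding N_def using x(2) y(2) by (intro exI[of _ "{(i, j)}"] exI[of _ "\<lambda>_. c * d"]) auto
        then show ?case
          using y leftB bB by simp
      qed
      then show ?case
        using xA by blast
    qed
    then show ?thesis by blast
  qed
  have "N t"
    using t by (induction rule: frag_induction) (auto intro: N_zero N_gen N_diff)
  then show ?thesis
    by (simp add: N_def nf_def)
qed

text \<open>This is the form needed for injectivity: the product has the same coefficients
  \<open>c z\<close> as the tensor, so once independence in S makes them vanish, the tensor is the
  unit.\<close>

lemma normal_form_frag_ev:
  fixes a :: "'i \<Rightarrow> 'k mpol" and b :: "'j \<Rightarrow> 'k mpol"
  assumes A: "A = add_span {cst c * a i |c i. i \<in> P}" and B: "B = add_span {cst c * b j |c j. j \<in> Q}"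
    and comm: "\<And>c i. a i * cst c = cst c * a i"
    and x: "x \<in> carrier T"
  obtains Z c where "finite Z" "Z \<subseteq> P \<times> Q"
    "tensor_mult x = (\<Sum>z\<in>Z. cst (c z) * (a (fst z) * b (snd z)))"
    "(\<forall>z\<in>Z. c z = 0) \<longrightarrow> x = \<one>\<^bsub>T\<^esub>"
proof -
  obtain t where t: "x = cls t" "Poly_Mapping.keys t \<subseteq> A \<times> B"
    using x by (auto simp: carrier_T)
  obtain Z c where Z: "finite Z" "Z \<subseteq> P \<times> Q"
    "t - (\<Sum>z\<in>Z. frag_of (cst (c z) * a (fst z), b (snd z))) \<in> K"
    using normal_form[OF A B comm t(2)] by blast
  have "tensor_mult x = (\<Sum>z\<in>Z. cst (c z) * (a (fst z) * b (snd z)))"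
    using frag_ev_K[OF Z(3)] by (simp add: t(1) tensor_mult_cls frag_ev_diff frag_ev_sum mult.assoc)
  moreover have "x = \<one>\<^bsub>T\<^esub>" if "\<forall>z\<in>Z. c z = 0"
  proof -
    have "b j \<in> B" if "j \<in> Q" for j
      unfolding B using that by (intro add_span.base CollectI exI[of _ 1]) auto
    then have "(\<Sum>z\<in>Z. frag_of (cst (c z) * a (fst z), b (snd z))) \<in> K"
      using that Z(2) by (intro sum_K) (auto intro!: frag_zero_left_K)
    from add_K[OF Z(3) this] have "t \<in> K"
      by simp
    then show ?thesis
      by (simp add: t(1) one_T cls_eq_iff)
  qed
  ultimately show ?thesis
    using that Z(1,2) by blast
qed

lemma tensor_mult_mult:
  assumes "x \<in> carrier T" "y \<in> carrier T"
  shows "tensor_mult (x \<otimes>\<^bsub>T\<^esub> y) = tensor_mult x + tensor_mult y"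
  using assms by (auto simp: carrier_T mult_T tensor_mult_cls frag_ev_add)

lemma tensor_mult_one: "tensor_mult \<one>\<^bsub>T\<^esub> = 0"
  by (simp add: one_T tensor_mult_cls)

lemma tensor_mult_smul:
  assumes "x \<in> carrier T"
  shows "tensor_mult (smul T c x) = cst c * tensor_mult x"
  using assms by (auto simp: carrier_T smul_T tensor_mult_cls frag_ev_smul)

text \<open>With invariant left factors, acting on the right factor alone is the same as acting on
  the product.\<close>

lemma tensor_mult_gact:
  assumes "g permutes {1..n}" "\<And>a. a \<in> A \<Longrightarrow> perm_act g a = a" "x \<in> carrier T"
  shows "tensor_mult (gact T g x) = perm_act g (tensor_mult x)"
proof -
  note g = permutes_bij[OF assms(1)]
  have diff: "perm_act g (p - q) = perm_act g p - perm_act g q" for p q :: "'k mpol"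
    using perm_act_add[OF g, of "p - q" q] by simp
  obtain t where t: "x = cls t" "Poly_Mapping.keys t \<subseteq> A \<times> B"
    using assms(3) by (auto simp: carrier_T)
  from t(2) have "frag_ev (frag_map (\<lambda>(a, b). (a, perm_act g b)) t) = perm_act g (frag_ev t)"
    by (induction rule: frag_induction)
      (auto simp: frag_map_diff frag_ev_diff diff perm_act_mult[OF g] assms(2))
  then show ?thesis
    by (simp add: t(1) gact_T[OF assms(1)] tensor_mult_cls)
qed

lemma tensor_mult_poly_ring:
  assumes "A \<subseteq> poly_ring n" "x \<in> carrier T"
  shows "tensor_mult x \<in> poly_ring n"
proof -
  obtain t where t: "x = cls t" "Poly_Mapping.keys t \<subseteq> A \<times> B"
    using assms(2) by (auto simp: carrier_T)
  have "B \<subseteq> poly_ring n"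
    using subB by (simp add: kG_submodule_def)
  then have "frag_ev t \<in> poly_ring n"
    unfolding frag_ev_def using t(2) assms(1) poly_ring_cst[of "of_int k :: 'k" n for k]
    by (intro poly_ring_sum poly_ring_mult) (auto simp: cst_def)
  then show ?thesis
    by (simp add: t(1) tensor_mult_cls)
qed

lemma ex_tensor:
  assumes "a \<in> A" "b \<in> B"
  shows "\<exists>x\<in>carrier T. tensor_mult x = a * b"
  using assms by (intro bexI[of _ "cls (frag_of (a, b))"]) (auto simp: tensor_mult_cls carrier_T)

end

section \<open>Direct sums\<close>

lemma kG_module_group: "kG_module n M \<Longrightarrow> group M"
  by (simp add: kG_module_def comm_group.axioms(2))

text \<open>The finite support demanded by \<open>sum_group\<close> is automatic over a finite index
  set.\<close>

lemma carrier_direct_sum_module: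
  assumes "finite J" "\<And>i. i \<in> J \<Longrightarrow> group (M i)"
  shows "carrier (direct_sum_module J M) = (\<Pi>\<^sub>E i\<in>J. carrier (M i))"
  using carrier_sum_group[of J M] assms by (simp add: direct_sum_module_def monoid.defs)

lemma mult_direct_sum_module: "x \<otimes>\<^bsub>direct_sum_module J M\<^esub> y = (\<lambda>i\<in>J. x i \<otimes>\<^bsub>M i\<^esub> y i)"
  by (simp add: direct_sum_module_def monoid.defs)

lemma one_direct_sum_module: "\<one>\<^bsub>direct_sum_module J M\<^esub> = (\<lambda>i\<in>J. \<one>\<^bsub>M i\<^esub>)"
  by (simp add: direct_sum_module_def monoid.defs)

lemma smul_direct_sum_module: "smul (direct_sum_module J M) c x = (\<lambda>i\<in>J. smul (M i) c (x i))"
  by (simp add: direct_sum_module_def monoid.defs kG_mod.defs)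

lemma gact_direct_sum_module: "gact (direct_sum_module J M) g x = (\<lambda>i\<in>J. gact (M i) g (x i))"
  by (simp add: direct_sum_module_def monoid.defs kG_mod.defs)

lemma kG_module_direct_sum_module:
  assumes J: "finite J" and M: "\<And>i. i \<in> J \<Longrightarrow> kG_module n (M i)"
  shows "kG_module n (direct_sum_module J M)"
proof -
  have grp: "group (M i)" if "i \<in> J" for i
    using M[OF that] by (rule kG_module_group)
  have cgrp: "comm_group (M i)" if "i \<in> J" for i
    using M[OF that] by (simp add: kG_module_def)
  have carr: "carrier (sum_group J M) = (\<Pi>\<^sub>E i\<in>J. carrier (M i))"
    using carrier_sum_group[of J M] J grp by simp
  have "comm_group (sum_group J M)"
  proof (rule group.group_comm_groupI)
    fix x y assume "x \<in> carrier (sum_group J M)" "y \<in> carrier (sum_group J M)"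
    then show "x \<otimes>\<^bsub>sum_group J M\<^esub> y = y \<otimes>\<^bsub>sum_group J M\<^esub> x"
      using cgrp by (auto simp: carr intro!: restrict_ext comm_monoid.m_comm dest: comm_group.axioms(1))
  qed (use grp in simp)
  then have 1: "comm_group (direct_sum_module J M)"
    by (rule comm_group_cong) (simp_all add: direct_sum_module_def monoid.defs)
  have carr': "carrier (direct_sum_module J M) = (\<Pi>\<^sub>E i\<in>J. carrier (M i))"
    using J grp by (rule carrier_direct_sum_module)
  note M' = M[unfolded kG_module_def]
  show ?thesis
    unfolding kG_module_def carr' mult_direct_sum_module
      smul_direct_sum_module gact_direct_sum_module
    by (intro conjI 1 allI ballI impI)
      (auto simp: M' PiE_iff restrict_def extensional_def fun_eq_iff)
qed

section \<open>The structure theorem\<close>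

lemma esym_subring_perm_act:
  assumes "g permutes {1..n}" "a \<in> esym_subring n I"
  shows "perm_act g a = a"
  using assms(2)
  by induction (auto simp: perm_act_cst perm_act_esym[OF assms(1)] perm_act_add perm_act_mult permutes_bij[OF assms(1)])

lemma esym_subring_poly_ring: "esym_subring n I \<subseteq> poly_ring n"
proof
  fix a :: "'k::ring_1 mpol" assume "a \<in> esym_subring n I"
  then show "a \<in> poly_ring n"
    by induction (auto intro: poly_ring_cst poly_ring_esym poly_ring_add poly_ring_mult)
qed

lemma keys_e_exp: "I \<subseteq> {1..n} \<Longrightarrow> Poly_Mapping.keys (e_exp n I) \<subseteq> {1..n}"
  unfolding e_exp_def by (intro keys_lam) (auto simp: finite_subset)

lemma V_gen_eq_add_span:
  assumes "n \<in> I" "I \<subseteq> {1..n}"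
  shows "(V_gen n I :: 'k::ring_1 mpol set) = add_span {cst c * xmonom m |c m. m \<in> orbit n I}"
proof -
  have "{cst c * xmonom m |c m. m \<in> orbit n I} =
      {cst c * xmonom (perm_exp g (e_exp n I)) :: 'k mpol |c g. g permutes {1..n}}"
    by (auto simp: orbit_def)
  then show ?thesis
    using assms by (simp add: V_gen_def e_gen_eq kG_span_xmonom_eq_add_span keys_e_exp)
qed

lemma add_span_empty: "add_span {} = {0}"
proof -
  have "x = 0" if "x \<in> add_span {}" for x :: 'a
    using that by induction auto
  then show ?thesis
    by (auto intro: add_span.zero)
qed

text \<open>The variable family \<open>J\<close> covers both the sum over the sets containing
  \<open>n\<close> and the sum over all subsets of \<open>{1..n}\<close>, where the additional
  summands are tensor products with \<open>{0}\<close>.\<close>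

lemma structure_iso:
  fixes X :: "nat set \<Rightarrow> 'k::ring_1 mpol set"
  assumes n: "n \<ge> 1" and J: "{I. n \<in> I \<and> I \<subseteq> {1..n}} \<subseteq> J" "J \<subseteq> Pow {1..n}"
    and X: "\<And>I. I \<in> J \<Longrightarrow> X I = (if n \<in> I then V_gen n I else {0})"
  shows "kG_iso n (structure_source n J X) (poly_module n) (structure_map J)"
proof -
  define A where "A = (\<lambda>I. esym_subring n I :: 'k mpol set)"
  define T where "T = (\<lambda>I. tensor_module (A I) (X I))"
  \<comment> \<open>Empty for \<open>n \<notin> I\<close>: then \<open>{0}\<close> is also a span
    over an index set, and such summands contribute no basis elements.\<close>
  define Orb where "Orb = (\<lambda>I. if n \<in> I then orbit n I else {})"
  let ?S = "structure_source n J X" and ?P = "poly_module n :: ('k mpol, 'k) kG_mod"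
  let ?f = "structure_map J :: _ \<Rightarrow> 'k mpol"
  have S: "?S = direct_sum_module J T"
    by (simp add: structure_source_def T_def A_def)
  have finJ: "finite J"
    using J(2) finite_subset by blast
  have A_span: "A I = add_span {cst c * dprod n M |c M. M \<in> {M. set_mset M \<subseteq> I}}" for I
    by (simp add: A_def esym_subring_eq_add_span)
  have X_span: "X I = add_span {cst c * xmonom m |c m. m \<in> Orb I}" if "I \<in> J" for I
    using that J(2) X[OF that] by (auto simp: Orb_def V_gen_eq_add_span add_span_empty)
  have tf: "tensor_factors n (A I) (X I)" if "I \<in> J" for I
  proof
    show "0 \<in> A I"
      using esym_subring.cst[of 0 n I] by (simp add: A_def)
    show "kG_submodule n (X I)"
    proof (cases "n \<in> I")
      case True
      have "I \<subseteq> {1..n}"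
        using J(2) that by blast
      then show ?thesis
        using True X[OF that] poly_ring_xmonom[OF keys_e_exp, of I n, where 'a = 'k]
        by (simp add: V_gen_def e_gen_eq kG_submodule_kG_span)
    next
      case False
      then show ?thesis
        using X[OF that] by (simp add: kG_submodule_def poly_ring_zero)
    qed
  qed (auto simp: A_def intro: esym_subring.intros)
  have kG_T: "kG_module n (T I)" if "I \<in> J" for I
    unfolding T_def by (rule tensor_factors.kG_module_T[OF tf[OF that]])
  have carr: "carrier ?S = (\<Pi>\<^sub>E I\<in>J. carrier (T I))"
    unfolding S using finJ kG_T by (intro carrier_direct_sum_module kG_module_group) auto
  have kG_S: "kG_module n ?S"
    unfolding S using finJ kG_T by (rule kG_module_direct_sum_module)
  have xT: "x I \<in> carrier (tensor_module (A I) (X I))" if "x \<in> carrier ?S" "I \<in> J" for x I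
    using that by (auto simp: carr T_def)
  have f_add: "?f (x \<otimes>\<^bsub>?S\<^esub> y) = ?f x + ?f y" if "x \<in> carrier ?S" "y \<in> carrier ?S" for x y
    unfolding structure_map_def sum.distrib[symmetric]
    using tensor_factors.tensor_mult_mult[OF tf xT[OF that(1)] xT[OF that(2)]]
    by (intro sum.cong) (simp_all add: S mult_direct_sum_module T_def)
  have closed: "?f x \<in> poly_ring n" if "x \<in> carrier ?S" for x
    unfolding structure_map_def
    by (intro poly_ring_sum tensor_factors.tensor_mult_poly_ring[OF tf])
      (use xT[OF that] esym_subring_poly_ring in \<open>auto simp: A_def\<close>)
  have smul: "?f (smul ?S c x) = smul ?P c (?f x)" if "x \<in> carrier ?S" for c x
    using tensor_factors.tensor_mult_smul[OF tf xT[OF that]]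
    by (simp add: structure_map_def S smul_direct_sum_module T_def poly_module_def sum_distrib_left)
  have gact: "?f (gact ?S g x) = gact ?P g (?f x)" if "g permutes {1..n}" "x \<in> carrier ?S" for g x
  proof -
    have "tensor_mult (gact (T I) g (x I)) = perm_act g (tensor_mult (x I))" if "I \<in> J" for I
      unfolding T_def
      by (rule tensor_factors.tensor_mult_gact[OF tf[OF that] \<open>g permutes {1..n}\<close> _ xT[OF \<open>x \<in> carrier ?S\<close> that]])
        (simp add: A_def esym_subring_perm_act[OF \<open>g permutes {1..n}\<close>])
    then show ?thesis
      by (simp add: structure_map_def S gact_direct_sum_module poly_module_def
          perm_act_sum permutes_bij[OF that(1)])
  qed
  have hom: "?f \<in> hom ?S ?P"
    using f_add closed by (auto simp: hom_def poly_module_def)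
  have "group_hom ?S ?P ?f"
    using hom kG_module_group[OF kG_S] kG_module_group[OF kG_module_poly_module]
    by (simp add: group_hom_def group_hom_axioms_def)
  then interpret f: group_hom ?S ?P ?f .
  have "inj_on ?f (carrier ?S)"
    unfolding f.inj_on_one_iff
  proof (intro allI impI)
    fix x assume x: "x \<in> carrier ?S" "?f x = \<one>\<^bsub>?P\<^esub>"
    \<comment> \<open>Bundled so that \<open>Z\<close> and \<open>c\<close> can be chosen for all
      \<open>I\<close> simultaneously.\<close>
    define Q where "Q = (\<lambda>I Z c. finite Z \<and> Z \<subseteq> {M. set_mset M \<subseteq> I} \<times> Orb I \<and>
      tensor_mult (x I) = (\<Sum>z\<in>Z. cst (c z) * bas n z) \<and>
      ((\<forall>z\<in>Z. c z = 0) \<longrightarrow> x I = \<one>\<^bsub>T I\<^esub>))"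
    have "\<exists>Z c. Q I Z c" if I: "I \<in> J" for I
    proof -
      obtain Z c where Z: "finite Z" "Z \<subseteq> {M. set_mset M \<subseteq> I} \<times> Orb I"
        "tensor_mult (x I) = (\<Sum>z\<in>Z. cst (c z) * (dprod n (fst z) * xmonom (snd z)))"
        "(\<forall>z\<in>Z. c z = 0) \<longrightarrow> x I = \<one>\<^bsub>tensor_module (A I) (X I)\<^esub>"
        by (rule tensor_factors.normal_form_frag_ev[OF tf[OF I] A_span X_span[OF I] dprod_commute xT[OF x(1) I]])
          (rule that)
      then show ?thesis
        unfolding Q_def bas_def T_def by blast
    qed
    then obtain Z c where "\<And>I. I \<in> J \<Longrightarrow> Q I (Z I) (c I)"
      by metis
    then have Z: "\<And>I. I \<in> J \<Longrightarrow> finite (Z I)"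
      "\<And>I. I \<in> J \<Longrightarrow> Z I \<subseteq> {M. set_mset M \<subseteq> I} \<times> Orb I"
      "\<And>I. I \<in> J \<Longrightarrow> tensor_mult (x I) = (\<Sum>z\<in>Z I. cst (c I z) * bas n z)"
      "\<And>I. I \<in> J \<Longrightarrow> (\<forall>z\<in>Z I. c I z = 0) \<longrightarrow> x I = \<one>\<^bsub>T I\<^esub>"
      unfolding Q_def by blast+
    have "0 = (\<Sum>I\<in>J. \<Sum>z\<in>Z I. cst (c I z) * bas n z)"
      using x(2) Z(3) by (simp add: structure_map_def poly_module_def)
    \<comment> \<open>A nested pair \<open>(I, (M, m))\<close> is a triple of \<open>idx n\<close>,
      so the double sum is one combination of distinctly indexed basis elements.\<close>
    also have "\<dots> = (\<Sum>t\<in>Sigma J Z. cst (c (fst t) (snd t)) * bas n (snd t))"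
      using finJ Z(1) by (simp add: sum.Sigma case_prod_unfold)
    finally have zero: "(\<Sum>t\<in>Sigma J Z. cst (c (fst t) (snd t)) * bas n (snd t)) = 0"
      by simp
    have "Sigma J Z \<subseteq> idx n"
      using Z(2) J(2) by (fastforce simp: idx_def Orb_def split: if_splits)
    then have "c (fst t) (snd t) = 0" if "t \<in> Sigma J Z" for t
      using bas_independent[OF _ _ zero that] finJ Z(1) by blast
    then have "x I = \<one>\<^bsub>T I\<^esub>" if "I \<in> J" for I
      using Z(4)[OF that] that by force
    then show "x = \<one>\<^bsub>?S\<^esub>"
      using x(1)[unfolded carr] unfolding S one_direct_sum_module
      by (simp add: fun_eq_iff PiE_iff extensional_def)
  qed
  moreover have "p \<in> ?f ` carrier ?S" if "p \<in> poly_ring n" for p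
    using poly_ring_bas_span[OF n that]
  proof induction
    case zero
    show ?case
      using f.hom_one f.G.one_closed by (force simp: poly_module_def)
  next
    case (add p q)
    then obtain x y where "x \<in> carrier ?S" "p = ?f x" "y \<in> carrier ?S" "q = ?f y"
      by blast
    then show ?case
      using f_add[of x y] f.G.m_closed[of x y] by (metis image_eqI)
  next
    case (base p)
    then obtain c I M m where p: "p = cst c * (dprod n M * xmonom m)" "(I, M, m) \<in> idx n"
      by (auto simp: bas_def)
    then have I: "I \<in> J" "set_mset M \<subseteq> I" "m \<in> Orb I"
      using J(1) by (auto simp: idx_def Orb_def)
    have "cst c * dprod n M \<in> A I"
      unfolding A_span using I(2) by (intro add_span.base) blast
    moreover have "xmonom m \<in> X I"
      unfolding X_span[OF I(1)] using I(3)
      by (intro add_span.base CollectI exI[of _ "1 :: 'k"] exI[of _ m]) simp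
    ultimately obtain y where y: "y \<in> carrier (T I)" "tensor_mult y = p"
      using tensor_factors.ex_tensor[OF tf[OF I(1)]] unfolding T_def p(1) mult.assoc[symmetric] by blast
    define x where "x = (\<lambda>I'\<in>J. if I' = I then y else \<one>\<^bsub>T I'\<^esub>)"
    have "\<one>\<^bsub>T I'\<^esub> \<in> carrier (T I')" if "I' \<in> J" for I'
      by (intro monoid.one_closed group.is_monoid kG_module_group[OF kG_T[OF that]])
    then have x: "x \<in> carrier ?S"
      using y(1) by (simp add: carr x_def)
    have "?f x = (\<Sum>I'\<in>J. if I' = I then p else 0)"
      unfolding structure_map_def x_def
      using y(2) tensor_factors.tensor_mult_one[OF tf] by (intro sum.cong) (auto simp: T_def)
    also have "\<dots> = p"
      using I(1) finJ by simp
    finally show ?case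
      using x by blast
  qed
  ultimately have "bij_betw ?f (carrier ?S) (carrier ?P)"
    using closed by (auto simp: bij_betw_def poly_module_def)
  then show ?thesis
    unfolding kG_iso_def iso_def using kG_S kG_module_poly_module hom smul gact by blast
qed

theorem theorem2p1:
  fixes n :: nat
  assumes "n \<ge> 1"
  shows "kG_iso n
           (structure_source n {I. {n} \<subseteq> I \<and> I \<subseteq> {1..n}}
             (V_gen n :: nat set \<Rightarrow> 'k::ring_1_no_zero_divisors mpol set))
           (poly_module n)
           (structure_map {I. {n} \<subseteq> I \<and> I \<subseteq> {1..n}}) \<and>
         structure_theorem n
           (\<lambda>I. if n \<in> I then V_gen n I else ({0} :: 'k mpol set))"
proof -
  have "\<exists>E. finite E \<and> E \<subseteq> poly_ring n \<and> (if n \<in> I then V_gen n I else ({0} :: 'k mpol set)) = kG_span n E"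
    if "I \<subseteq> {1..n}" for I
  proof (cases "n \<in> I")
    case True
    then show ?thesis
      using that poly_ring_xmonom[OF keys_e_exp[OF that], where 'a = 'k]
      by (intro exI[of _ "{e_gen n I}"]) (simp add: V_gen_def e_gen_eq)
  next
    case False
    have "kG_submodule n ({0} :: 'k mpol set)"
      by (simp add: kG_submodule_def poly_ring_zero)
    then have "kG_span n {} = ({0} :: 'k mpol set)"
      unfolding kG_span_def by (intro equalityI) (blast, auto simp: kG_submodule_def)
    then show ?thesis
      using False by (intro exI[of _ "{}"]) simp
  qed
  then have fg: "\<forall>I\<in>Pow {1..n}. \<exists>E. finite E \<and> E \<subseteq> poly_ring n \<and>
      (if n \<in> I then V_gen n I else ({0} :: 'k mpol set)) = kG_span n E"
    by blast
  have "kG_iso n (structure_source n {I. {n} \<subseteq> I \<and> I \<subseteq> {1..n}} (V_gen n :: nat set \<Rightarrow> 'k mpol set))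
      (poly_module n) (structure_map {I. {n} \<subseteq> I \<and> I \<subseteq> {1..n}})"
    by (rule structure_iso[OF assms]) auto
  moreover have "kG_iso n (structure_source n (Pow {1..n}) (\<lambda>I. if n \<in> I then V_gen n I else ({0} :: 'k mpol set)))
      (poly_module n) (structure_map (Pow {1..n}))"
    by (rule structure_iso[OF assms]) auto
  ultimately show ?thesis
    unfolding structure_theorem_def using fg by (intro conjI)
qed

end
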